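(* Let $(M,\boldsymbol\eta)$ be a co-oriented $k$-contact manifold, $\mathcal D=\ker\boldsymbol\eta$, and let $X\in\mathfrak X(M)$ be a $k$-contact vector field with $\boldsymbol\eta$-Hamiltonian $\boldsymbol h_X$. Then $\mathcal L_{\mathcal D}(X)=\boldsymbol h_X^{-1}(0)$, and $\mathcal L_{\mathcal D}(X)$ is invariant under the local flow of $X$. If, in addition, $X$ is a polarised $k$-contact vector field relative to the polarised $k$-contact manifold $(M,\ker\boldsymbol\eta,\mathcal P)$, then $\mathcal L_{\mathcal P}(X)$ is invariant under the local flow of $X$.
   Context: A co-oriented $k$-contact manifold $(M,\boldsymbol\eta)$ is a manifold with an $\mathbb R^k$-valued one-form $\boldsymbol\eta=\sum_A\eta^A\otimes e_A$ such that $\ker\boldsymbol\eta=\bigcap_A\ker\eta^A$ is a non-zero distribution of corank $k$ and $\ker\boldsymbol\eta\oplus\ker d\boldsymbol\eta=TM$, $\ker d\boldsymbol\eta=\bigcap_A\ker d\eta^A$. A $k$-contact vector field is $X\in\mathfrak X(M)$ with $[X,\Gamma(\mathcal D)]\subset\Gamma(\mathcal D)$; its $\boldsymbol\eta$-Hamiltonian is $\boldsymbol h_X=-\iota_X\boldsymbol\eta:M\to\mathbb R^k$. A polarisation $\mathcal P\subset\mathcal D$ is an integrable Legendrian subbundle of maximal rank among integrable Legendrian subbundles of $\mathcal D$, where, with the Levi tensor $\mathcal L_{\mathcal D}(Y_x,Z_x)=[Y,Z]_x\bmod\mathcal D_x$ on $\mathcal D$, a subspace of $\mathcal D_x$ is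 isotropic if the Levi tensor vanishes on it, and Legendrian if moreover it admits an isotropic complement in $\mathcal D_x$. $X$ is a polarised $k$-contact vector field if it is $k$-contact and $[X,\Gamma(\mathcal P)]\subset\Gamma(\mathcal P)$. The loci are $\mathcal L_{\mathcal D}(X)=\{x\in M:X_x\in\mathcal D_x\}$ and $\mathcal L_{\mathcal P}(X)=\{x\in M:X_x\in\mathcal P_x\}$. *)

theory Defs
  imports "HOL-Analysis.Analysis" "HOL-Library.Function_Algebras"
begin

instantiation "fun" :: (type, real_vector) real_vector
begin

definition scaleR_fun :: "real \<Rightarrow> ('a \<Rightarrow> 'b) \<Rightarrow> 'a \<Rightarrow> 'b"
  where "scaleR_fun r f = (\<lambda>x. r *\<^sub>R f x)"

instance
  by standard (simp_all add: scaleR_fun_def fun_eq_iff scaleR_add_right scaleR_add_left)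

end


section \<open>Smooth manifolds, tangent vectors and vector fields\<close>

text \<open>
  Meant for open \<open>S\<close> in a Euclidean space, where \<open>C\<^sup>k\<^sup>+\<^sup>1\<close> means: differentiable with all
  directional derivatives of class \<open>C\<^sup>k\<close>.
\<close>

primrec Ck_on :: "nat \<Rightarrow> 'a::euclidean_space set \<Rightarrow> ('a \<Rightarrow> 'b::real_normed_vector) \<Rightarrow> bool"
  where
    "Ck_on 0 S f \<longleftrightarrow> continuous_on S f"
  | "Ck_on (Suc k) S f \<longleftrightarrow>
       (\<forall>x\<in>S. f differentiable (at x)) \<and>
       (\<forall>v. Ck_on k S (\<lambda>x. frechet_derivative f (at x) v))"

definition smooth_on :: "'a::euclidean_space set \<Rightarrow> ('a \<Rightarrow> 'b::real_normed_vector) \<Rightarrow> bool"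
  where "smooth_on S f \<longleftrightarrow> (\<forall>k. Ck_on k S f)"

type_synonym ('m, 'e) chart = "'m set \<times> ('m \<Rightarrow> 'e)"

definition is_chart :: "('m::topological_space, 'e::euclidean_space) chart \<Rightarrow> bool"
  where "is_chart = (\<lambda>(U, \<phi>). open U \<and> open (\<phi> ` U) \<and> homeomorphism U (\<phi> ` U) \<phi> (inv_into U \<phi>))"

text \<open>
  The manifold is the whole type \<open>'m\<close>, whose topology is required to be Hausdorff and second
  countable; it is modelled on \<open>'e\<close>, so it has dimension \<open>DIM('e)\<close> and no boundary.
\<close>

definition smooth_atlas ::
    "('m::{t2_space, second_countable_topology}, 'e::euclidean_space) chart set \<Rightarrow> bool"
  where "smooth_atlas \<A> \<longleftrightarrow>
    (\<forall>c\<in>\<A>. is_chart c) \<and>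
    (\<Union>c\<in>\<A>. fst c) = UNIV \<and>
    (\<forall>(U, \<phi>)\<in>\<A>. \<forall>(V, \<psi>)\<in>\<A>. smooth_on (\<phi> ` (U \<inter> V)) (\<psi> \<circ> inv_into U \<phi>))"

definition smooth_functions :: "('m, 'e::euclidean_space) chart set \<Rightarrow> ('m \<Rightarrow> real) set"
  where "smooth_functions \<A> = {f. \<forall>(U, \<phi>)\<in>\<A>. smooth_on (\<phi> ` U) (f \<circ> inv_into U \<phi>)}"

text \<open>
  A tangent vector is identified with its action on smooth functions, \<open>f \<mapsto> v f\<close>. To make this
  determine it as an element of the function type, it is \<open>0\<close> on functions that are not smooth.
\<close>

type_synonym 'm tvec = "('m \<Rightarrow> real) \<Rightarrow> real"

text \<open>
  \<open>coord_tvec \<A> (U, \<phi>) x u\<close> is the vector \<open>\<Sum>i. u\<^sup>i (\<partial>/\<partial>x\<^sup>i)\<close> at \<open>x\<close> for the coordinates \<open>\<phi>\<close>.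
\<close>

definition coord_tvec ::
    "('m, 'e::euclidean_space) chart set \<Rightarrow> ('m, 'e) chart \<Rightarrow> 'm \<Rightarrow> 'e \<Rightarrow> 'm tvec"
  where "coord_tvec \<A> = (\<lambda>(U, \<phi>) x u f.
    if f \<in> smooth_functions \<A> then frechet_derivative (f \<circ> inv_into U \<phi>) (at (\<phi> x)) u else 0)"

definition tangent_space :: "('m, 'e::euclidean_space) chart set \<Rightarrow> 'm \<Rightarrow> 'm tvec set"
  where "tangent_space \<A> x = {coord_tvec \<A> c x u | c u. c \<in> \<A> \<and> x \<in> fst c}"

definition vector_fields :: "('m, 'e::euclidean_space) chart set \<Rightarrow> ('m \<Rightarrow> 'm tvec) set"
  where "vector_fields \<A> = {X.
    (\<forall>x. X x \<in> tangent_space \<A> x) \<and>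
    (\<forall>f\<in>smooth_functions \<A>. (\<lambda>x. X x f) \<in> smooth_functions \<A>)}"

definition lie_bracket :: "('m \<Rightarrow> 'm tvec) \<Rightarrow> ('m \<Rightarrow> 'm tvec) \<Rightarrow> 'm \<Rightarrow> 'm tvec"
  where "lie_bracket X Y = (\<lambda>x f. X x (\<lambda>y. Y y f) - Y x (\<lambda>y. X y f))"


section \<open>Differential one-forms\<close>

text \<open>The values of a form off the tangent spaces are irrelevant.\<close>

definition one_form ::
    "('m, 'e::euclidean_space) chart set \<Rightarrow> ('m \<Rightarrow> 'm tvec \<Rightarrow> real) \<Rightarrow> bool"
  where "one_form \<A> \<omega> \<longleftrightarrow>
    (\<forall>x. \<forall>v\<in>tangent_space \<A> x. \<forall>w\<in>tangent_space \<A> x. \<omega> x (v + w) = \<omega> x v + \<omega> x w) \<and>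
    (\<forall>x. \<forall>v\<in>tangent_space \<A> x. \<forall>r. \<omega> x (r *\<^sub>R v) = r * \<omega> x v) \<and>
    (\<forall>Y\<in>vector_fields \<A>. (\<lambda>x. \<omega> x (Y x)) \<in> smooth_functions \<A>)"

text \<open>
  The value is \<open>Y(\<omega>(Z)) - Z(\<omega>(Y)) - \<omega>([Y, Z])\<close> at \<open>x\<close> for vector fields \<open>Y\<close>, \<open>Z\<close> extending \<open>v\<close>,
  \<open>w\<close>; for a one-form it does not depend on the extensions.
\<close>

definition ext_deriv ::
    "('m, 'e::euclidean_space) chart set \<Rightarrow> ('m \<Rightarrow> 'm tvec \<Rightarrow> real) \<Rightarrow>
      'm \<Rightarrow> 'm tvec \<Rightarrow> 'm tvec \<Rightarrow> real"
  where "ext_deriv \<A> \<omega> x v w = (THE r. \<exists>Y\<in>vector_fields \<A>. \<exists>Z\<in>vector_fields \<A>.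
    Y x = v \<and> Z x = w \<and>
    r = Y x (\<lambda>y. \<omega> y (Z y)) - Z x (\<lambda>y. \<omega> y (Y y)) - \<omega> x (lie_bracket Y Z x))"

definition component :: "('m \<Rightarrow> 'm tvec \<Rightarrow> real ^ 'k) \<Rightarrow> 'k \<Rightarrow> 'm \<Rightarrow> 'm tvec \<Rightarrow> real"
  where "component \<eta> i = (\<lambda>x v. \<eta> x v $ i)"

definition ker_form ::
    "('m, 'e::euclidean_space) chart set \<Rightarrow> ('m \<Rightarrow> 'm tvec \<Rightarrow> real ^ 'k) \<Rightarrow> 'm \<Rightarrow> 'm tvec set"
  where "ker_form \<A> \<eta> x = (\<Inter>i. {v \<in> tangent_space \<A> x. component \<eta> i x v = 0})"

definition ker_ext_deriv ::
    "('m, 'e::euclidean_space) chart set \<Rightarrow> ('m \<Rightarrow> 'm tvec \<Rightarrow> real ^ 'k) \<Rightarrow> 'm \<Rightarrow> 'm tvec set"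
  where "ker_ext_deriv \<A> \<eta> x =
    (\<Inter>i. {v \<in> tangent_space \<A> x. \<forall>w\<in>tangent_space \<A> x. ext_deriv \<A> (component \<eta> i) x v w = 0})"


section \<open>Subbundles of the tangent bundle\<close>

text \<open>
  The local frame consists of restrictions of global vector fields; cutting off with bump functions
  shows that this is no restriction.
\<close>

definition subbundle ::
    "('m::topological_space, 'e::euclidean_space) chart set \<Rightarrow> nat \<Rightarrow> ('m \<Rightarrow> 'm tvec set) \<Rightarrow> bool"
  where "subbundle \<A> r E \<longleftrightarrow>
    (\<forall>x. subspace (E x) \<and> E x \<subseteq> tangent_space \<A> x \<and> dim (E x) = r) \<and>
    (\<forall>x. \<exists>U Y. open U \<and> x \<in> U \<and> (\<forall>i<r. Y i \<in> vector_fields \<A>) \<and>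
       (\<forall>y\<in>U. E y = span ((\<lambda>i. Y i y) ` {..<r})))"

definition sections ::
    "('m, 'e::euclidean_space) chart set \<Rightarrow> ('m \<Rightarrow> 'm tvec set) \<Rightarrow> ('m \<Rightarrow> 'm tvec) set"
  where "sections \<A> E = {Y \<in> vector_fields \<A>. \<forall>x. Y x \<in> E x}"

text \<open>
  Integrability in the sense of foliated charts: around every point there are coordinates,
  compatible with the atlas, in which the subbundle is the constant subspace \<open>S\<close>; the slices
  parallel to \<open>S\<close> are its integral manifolds.
\<close>

definition integrable_subbundle ::
    "('m::{t2_space, second_countable_topology}, 'e::euclidean_space) chart set \<Rightarrow>
      ('m \<Rightarrow> 'm tvec set) \<Rightarrow> bool"
  where "integrable_subbundle \<A> E \<longleftrightarrow>
    (\<forall>x. \<exists>c S. smooth_atlas (insert c \<A>) \<and> x \<in> fst c \<and> subspace S \<and>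
       (\<forall>y\<in>fst c. E y = coord_tvec \<A> c y ` S))"

definition direct_sum :: "'a::real_vector set \<Rightarrow> 'a set \<Rightarrow> 'a set \<Rightarrow> bool"
  where "direct_sum V W T \<longleftrightarrow> V \<inter> W = {0} \<and> {v + w | v w. v \<in> V \<and> w \<in> W} = T"


section \<open>Co-oriented k-contact manifolds\<close>

definition k_contact_manifold ::
    "('m::{t2_space, second_countable_topology}, 'e::euclidean_space) chart set \<Rightarrow>
      ('m \<Rightarrow> 'm tvec \<Rightarrow> real ^ 'k) \<Rightarrow> bool"
  where "k_contact_manifold \<A> \<eta> \<longleftrightarrow>
    smooth_atlas \<A> \<and>
    (\<forall>i. one_form \<A> (component \<eta> i)) \<and>
    (\<exists>r. subbundle \<A> r (ker_form \<A> \<eta>) \<and> r \<noteq> 0 \<and>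
       (\<forall>x. dim (tangent_space \<A> x) = r + CARD('k))) \<and>
    (\<forall>x. direct_sum (ker_form \<A> \<eta> x) (ker_ext_deriv \<A> \<eta> x) (tangent_space \<A> x))"

definition preserves_sections ::
    "('m, 'e::euclidean_space) chart set \<Rightarrow> ('m \<Rightarrow> 'm tvec) \<Rightarrow> ('m \<Rightarrow> 'm tvec set) \<Rightarrow> bool"
  where "preserves_sections \<A> X E \<longleftrightarrow> lie_bracket X ` sections \<A> E \<subseteq> sections \<A> E"

definition k_contact_field ::
    "('m, 'e::euclidean_space) chart set \<Rightarrow> ('m \<Rightarrow> 'm tvec set) \<Rightarrow> ('m \<Rightarrow> 'm tvec) \<Rightarrow> bool"
  where "k_contact_field \<A> D X \<longleftrightarrow> X \<in> vector_fields \<A> \<and> preserves_sections \<A> X D"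

definition hamiltonian ::
    "('m \<Rightarrow> 'm tvec \<Rightarrow> real ^ 'k) \<Rightarrow> ('m \<Rightarrow> 'm tvec) \<Rightarrow> 'm \<Rightarrow> real ^ 'k"
  where "hamiltonian \<eta> X = (\<lambda>x. - \<eta> x (X x))"

text \<open>
  An element of the quotient of the tangent space at \<open>x\<close> by \<open>D x\<close> is represented as a coset of
  \<open>D x\<close>, so its zero is \<open>D x\<close> itself. By tensoriality the set below is a single coset.
\<close>

definition levi ::
    "('m, 'e::euclidean_space) chart set \<Rightarrow> ('m \<Rightarrow> 'm tvec set) \<Rightarrow>
      'm \<Rightarrow> 'm tvec \<Rightarrow> 'm tvec \<Rightarrow> 'm tvec set"
  where "levi \<A> D x v w = {lie_bracket Y Z x + u | Y Z u.
    Y \<in> sections \<A> D \<and> Z \<in> sections \<A> D \<and> Y x = v \<and> Z x = w \<and> u \<in> D x}"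

definition isotropic ::
    "('m, 'e::euclidean_space) chart set \<Rightarrow> ('m \<Rightarrow> 'm tvec set) \<Rightarrow> 'm \<Rightarrow> 'm tvec set \<Rightarrow> bool"
  where "isotropic \<A> D x W \<longleftrightarrow>
    subspace W \<and> W \<subseteq> D x \<and> (\<forall>v\<in>W. \<forall>w\<in>W. levi \<A> D x v w = D x)"

definition legendrian ::
    "('m, 'e::euclidean_space) chart set \<Rightarrow> ('m \<Rightarrow> 'm tvec set) \<Rightarrow> 'm \<Rightarrow> 'm tvec set \<Rightarrow> bool"
  where "legendrian \<A> D x W \<longleftrightarrow>
    isotropic \<A> D x W \<and> (\<exists>W'. isotropic \<A> D x W' \<and> direct_sum W W' (D x))"

definition integrable_legendrian ::
    "('m::{t2_space, second_countable_topology}, 'e::euclidean_space) chart set \<Rightarrow>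
      ('m \<Rightarrow> 'm tvec set) \<Rightarrow> nat \<Rightarrow> ('m \<Rightarrow> 'm tvec set) \<Rightarrow> bool"
  where "integrable_legendrian \<A> D r P \<longleftrightarrow>
    subbundle \<A> r P \<and> (\<forall>x. legendrian \<A> D x (P x)) \<and> integrable_subbundle \<A> P"

definition polarisation ::
    "('m::{t2_space, second_countable_topology}, 'e::euclidean_space) chart set \<Rightarrow>
      ('m \<Rightarrow> 'm tvec set) \<Rightarrow> ('m \<Rightarrow> 'm tvec set) \<Rightarrow> bool"
  where "polarisation \<A> D P \<longleftrightarrow>
    (\<exists>r. integrable_legendrian \<A> D r P \<and>
       (\<forall>r' P'. integrable_legendrian \<A> D r' P' \<longrightarrow> r' \<le> r))"

definition polarised_k_contact_field ::
    "('m, 'e::euclidean_space) chart set \<Rightarrow> ('m \<Rightarrow> 'm tvec set) \<Rightarrow> ('m \<Rightarrow> 'm tvec set) \<Rightarrow>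
      ('m \<Rightarrow> 'm tvec) \<Rightarrow> bool"
  where "polarised_k_contact_field \<A> D P X \<longleftrightarrow>
    k_contact_field \<A> D X \<and> preserves_sections \<A> X P"

definition locus :: "('m \<Rightarrow> 'm tvec set) \<Rightarrow> ('m \<Rightarrow> 'm tvec) \<Rightarrow> 'm set"
  where "locus E X = {x. X x \<in> E x}"


section \<open>Local flows\<close>

definition integral_curve ::
    "('m::topological_space, 'e::euclidean_space) chart set \<Rightarrow> ('m \<Rightarrow> 'm tvec) \<Rightarrow>
      real set \<Rightarrow> (real \<Rightarrow> 'm) \<Rightarrow> bool"
  where "integral_curve \<A> X I \<gamma> \<longleftrightarrow>
    open I \<and> is_interval I \<and> continuous_on I \<gamma> \<and>
    (\<forall>t\<in>I. \<forall>f\<in>smooth_functions \<A>. (f \<circ> \<gamma> has_real_derivative X (\<gamma> t) f) (at t))"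

text \<open>
  The local flow as a graph: \<open>local_flow \<A> X t x y\<close> says that the flow of \<open>X\<close> from \<open>x\<close> is defined
  up to time \<open>t\<close> (positive or negative) and takes \<open>x\<close> to \<open>y\<close>.
\<close>

definition local_flow ::
    "('m::topological_space, 'e::euclidean_space) chart set \<Rightarrow> ('m \<Rightarrow> 'm tvec) \<Rightarrow>
      real \<Rightarrow> 'm \<Rightarrow> 'm \<Rightarrow> bool"
  where "local_flow \<A> X t x y \<longleftrightarrow>
    (\<exists>I \<gamma>. integral_curve \<A> X I \<gamma> \<and> 0 \<in> I \<and> t \<in> I \<and> \<gamma> 0 = x \<and> \<gamma> t = y)"

definition flow_invariant ::
    "('m::topological_space, 'e::euclidean_space) chart set \<Rightarrow> ('m \<Rightarrow> 'm tvec) \<Rightarrow> 'm set \<Rightarrow> bool"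
  where "flow_invariant \<A> X S \<longleftrightarrow> (\<forall>x\<in>S. \<forall>t y. local_flow \<A> X t x y \<longrightarrow> y \<in> S)"

end

theory Submission
  imports Defs
begin

text \<open>
  The equality of \<open>locus D X\<close> with the zero set of the Hamiltonian is the definition of \<open>ker \<eta>\<close>. Both
  invariance claims are instances of one fact about any subbundle \<open>E\<close> of the tangent bundle: if
  \<open>[X, \<Gamma>(E)] \<subseteq> \<Gamma>(E)\<close>, then \<open>{x. X x \<in> E x}\<close> is invariant under the flow of \<open>X\<close>
  (\<open>flow_invariant_locus\<close>). The usual argument is that the flow maps preserve \<open>E\<close> (because of the
  bracket condition) and preserve \<open>X\<close> itself (because \<open>[X, X] = 0\<close>). The proof below is the
  infinitesimal version of this, carried out along a single integral curve \<open>\<gamma>\<close>.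

  In a chart write \<open>c\<close> for the image of \<open>\<gamma>\<close> and \<open>\<xi>\<close> for the principal part of \<open>X\<close>, so \<open>c' = \<xi>(c)\<close>.
  Then \<open>u(t) = \<xi>(c(t))\<close> solves the linearised equation \<open>u' = L(t) u\<close> with \<open>L(t) = D\<xi>(c(t))\<close>. If
  \<open>y\<^sub>1, \<dots>, y\<^sub>r\<close> are the principal parts of a local frame of sections of \<open>E\<close>, then
  \<open>y\<^sub>i' = Dy\<^sub>i(\<xi>) = L y\<^sub>i + [\<xi>, y\<^sub>i]\<close> along \<open>c\<close>, and the bracket lies in the span of the
  \<open>y\<^sub>j\<close>: the moving subspace \<open>span y(t)\<close> is carried by the same linear
  equation, up to a correction inside itself. Hence the distance \<open>d(t)\<close> from \<open>u(t)\<close> to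
  \<open>span y(t)\<close> is continuous and satisfies \<open>D\<^sup>+d \<le> K d\<close> in the sense of Dini derivatives, with \<open>K\<close> a
  bound for \<open>L\<close>; if it vanishes at one time, it vanishes throughout the chart interval
  (\<open>invariant_span_along_linear_flow\<close>). Connectedness of the time interval then finishes the proof.

  Tangent vectors act on globally defined smooth functions only, and the bracket hypothesis speaks
  of global sections only. The passage to a chart therefore uses bump functions (\<open>smooth_bump\<close>,
  \<open>cutoff\<close>): they turn coordinates into global test functions, from which principal parts are read
  off, and local frames into frames of global sections.
\<close>


section \<open>Functions of class \<open>C\<^sup>k\<close> on open sets\<close>

text \<open>
  The recursive characterisation of \<open>C\<^sup>k\<^sup>+\<^sup>1\<close> through \<open>has_derivative\<close>, which is the form in which the
  differentiation rules of the library apply.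
\<close>

lemma Ck_on_Suc_iff_has_derivative:
  "Ck_on (Suc k) S f \<longleftrightarrow>
    (\<forall>x\<in>S. (f has_derivative frechet_derivative f (at x)) (at x)) \<and>
    (\<forall>v. Ck_on k S (\<lambda>x. frechet_derivative f (at x) v))"
  by (simp add: frechet_derivative_works)

lemma Ck_on_cong:
  assumes "open S" "\<And>x. x \<in> S \<Longrightarrow> f x = g x" "Ck_on k S f"
  shows "Ck_on k S g"
  using assms(2,3)
proof (induction k arbitrary: f g)
  case 0
  then show ?case by (auto cong: continuous_on_cong_simp)
next
  case (Suc k)
  have d: "(g has_derivative frechet_derivative f (at x)) (at x)" if "x \<in> S" for x
    using Suc.prems that assms(1) unfolding Ck_on_Suc_iff_has_derivative
    by (auto intro: has_derivative_transform_within_open)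
  then have "frechet_derivative f (at x) = frechet_derivative g (at x)" if "x \<in> S" for x
    using frechet_derivative_at that by blast
  then have "Ck_on k S (\<lambda>x. frechet_derivative g (at x) v)" for v
    using Suc.prems by - (rule Suc.IH[where f="\<lambda>x. frechet_derivative f (at x) v"], simp_all)
  then show ?case using d by (auto simp: differentiable_def)
qed

lemma Ck_on_SucI:
  assumes "open S" "\<And>x. x \<in> S \<Longrightarrow> (f has_derivative f' x) (at x)"
    and "\<And>v. Ck_on k S (\<lambda>x. f' x v)"
  shows "Ck_on (Suc k) S f"
proof -
  have "f' x = frechet_derivative f (at x)" if "x \<in> S" for x
    using assms(2)[OF that] frechet_derivative_at by blast
  then have "Ck_on k S (\<lambda>x. frechet_derivative f (at x) v)" for v
    by - (rule Ck_on_cong[OF assms(1) _ assms(3)], simp)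
  then show ?thesis using assms(2) by (auto simp: differentiable_def)
qed

lemma Ck_on_SucD: "Ck_on (Suc k) S f \<Longrightarrow> Ck_on k S f"
proof (induction k arbitrary: f)
  case 0
  then show ?case
    by (auto intro!: continuous_at_imp_continuous_on differentiable_imp_continuous_within)
next
  case (Suc k)
  have "(\<forall>x\<in>S. f differentiable (at x)) \<and>
      (\<forall>v. Ck_on (Suc k) S (\<lambda>x. frechet_derivative f (at x) v))"
    using Suc.prems unfolding Ck_on.simps(2)[of "Suc k"] .
  then show ?case using Suc.IH unfolding Ck_on.simps(2)[of k S f] by blast
qed

lemma Ck_on_frechet_derivative:
  "Ck_on (Suc k) S f \<Longrightarrow> Ck_on k S (\<lambda>x. frechet_derivative f (at x) v)"
  by simp

lemma Ck_on_subset: "Ck_on k S f \<Longrightarrow> T \<subseteq> S \<Longrightarrow> Ck_on k T f"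
  by (induction k arbitrary: f) (auto intro: continuous_on_subset)

lemma Ck_on_Un:
  assumes "open S" "open T" "Ck_on k S f" "Ck_on k T f"
  shows "Ck_on k (S \<union> T) f"
  using assms(3,4) by (induction k arbitrary: f) (auto intro: continuous_on_open_Un assms)

lemma Ck_on_locally:
  assumes "\<And>x. x \<in> S \<Longrightarrow> \<exists>T. open T \<and> x \<in> T \<and> Ck_on k T f"
  shows "Ck_on k S f"
  using assms
proof (induction k arbitrary: f)
  case 0
  then show ?case
    by (metis Ck_on.simps(1) continuous_at_imp_continuous_on continuous_on_eq_continuous_at)
next
  case (Suc k)
  have "f differentiable (at x)" if "x \<in> S" for x
    using Suc.prems[OF that] by auto
  moreover have "Ck_on k S (\<lambda>x. frechet_derivative f (at x) v)" for v
  proof (rule Suc.IH)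
    show "\<exists>T. open T \<and> x \<in> T \<and> Ck_on k T (\<lambda>x. frechet_derivative f (at x) v)" if "x \<in> S" for x
      using Suc.prems[OF that] by auto
  qed
  ultimately show ?case by simp
qed

text \<open>
  From here on class \<open>C\<^sup>k\<^sup>+\<^sup>1\<close> is handled through the lemmas above; unfolding it automatically would
  replace every function by its derivatives.
\<close>

declare Ck_on.simps(2) [simp del]

lemma Ck_on_const: "open S \<Longrightarrow> Ck_on k S (\<lambda>x. c)"
proof (induction k arbitrary: c)
  case (Suc k)
  then show ?case by (intro Ck_on_SucI[where f' = "\<lambda>x v. 0"]) auto
qed simp

lemma Ck_on_bounded_linear:
  assumes "open S" "bounded_linear f" shows "Ck_on k S f"
proof (cases k)
  case 0
  then show ?thesis using assms linear_continuous_on by auto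
next
  case (Suc j)
  then show ?thesis
    using assms by (auto intro!: Ck_on_SucI[where f' = "\<lambda>x v. f v"] Ck_on_const bounded_linear_imp_has_derivative)
qed

lemma Ck_on_add:
  assumes "open S" "Ck_on k S f" "Ck_on k S g"
  shows "Ck_on k S (\<lambda>x. f x + g x)"
  using assms(2,3)
proof (induction k arbitrary: f g)
  case (Suc k)
  show ?case
    by (rule Ck_on_SucI[where f' = "\<lambda>x v. frechet_derivative f (at x) v + frechet_derivative g (at x) v"])
       (use Suc assms(1) in \<open>auto simp: Ck_on_Suc_iff_has_derivative intro: has_derivative_add\<close>)
qed (auto intro: continuous_on_add)

lemma Ck_on_sum:
  assumes "open S" "finite I" "\<And>i. i \<in> I \<Longrightarrow> Ck_on k S (f i)"
  shows "Ck_on k S (\<lambda>x. \<Sum>i\<in>I. f i x)"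
  using assms(2,3) by (induction I rule: finite_induct) (auto intro: Ck_on_const Ck_on_add assms(1))

text \<open>
  By the Leibniz rule the derivative of a product is a sum of products, whose factors are of class
  \<open>C\<^sup>k\<close> if the original factors are of class \<open>C\<^sup>k\<^sup>+\<^sup>1\<close>.
\<close>

lemma (in bounded_bilinear) Ck_on:
  assumes "open S" "Ck_on k S f" "Ck_on k S g"
  shows "Ck_on k S (\<lambda>x. prod (f x) (g x))"
  using assms(2,3)
proof (induction k arbitrary: f g)
  case (Suc k)
  show ?case
  proof (rule Ck_on_SucI[where f' = "\<lambda>x v.
      prod (f x) (frechet_derivative g (at x) v) + prod (frechet_derivative f (at x) v) (g x)"])
    show "Ck_on k S (\<lambda>x. prod (f x) (frechet_derivative g (at x) v) +
             prod (frechet_derivative f (at x) v) (g x))" for v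
      using Suc.prems by (intro Ck_on_add assms(1) Suc.IH) (auto dest: Ck_on_SucD Ck_on_frechet_derivative)
  qed (use Suc.prems assms(1) in \<open>auto simp: Ck_on_Suc_iff_has_derivative intro: FDERIV\<close>)
qed (auto intro: continuous_on)

lemma frechet_derivative_Basis_sum:
  fixes f :: "'a::euclidean_space \<Rightarrow> 'b::real_normed_vector"
  assumes "f differentiable (at x)"
  shows "frechet_derivative f (at x) v = (\<Sum>b\<in>Basis. (v \<bullet> b) *\<^sub>R frechet_derivative f (at x) b)"
proof -
  note lin = linear_frechet_derivative[OF assms]
  have "frechet_derivative f (at x) (\<Sum>b\<in>Basis. (v \<bullet> b) *\<^sub>R b) =
    (\<Sum>b\<in>Basis. (v \<bullet> b) *\<^sub>R frechet_derivative f (at x) b)"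
    by (simp only: linear_sum[OF lin] linear_scale[OF lin])
  then show ?thesis by (simp only: euclidean_representation)
qed

text \<open>
  The chain rule, expanded over a basis, expresses a directional derivative of \<open>f \<circ> g\<close> through
  derivatives of \<open>f\<close> in \<^emph>\<open>fixed\<close> directions composed with \<open>g\<close>; this is what makes the induction
  over \<open>k\<close> go through.
\<close>

lemma Ck_on_compose:
  fixes g :: "'a::euclidean_space \<Rightarrow> 'b::euclidean_space" and f :: "'b \<Rightarrow> 'c::real_normed_vector"
  assumes "open S" "g ` S \<subseteq> T" "Ck_on k S g" "Ck_on k T f"
  shows "Ck_on k S (\<lambda>x. f (g x))"
  using assms(3,4)
proof (induction k arbitrary: f)
  case 0
  then show ?case using assms(2) by (auto intro: continuous_on_compose2)
next
  case (Suc k)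
  note g = Suc.prems(1)[unfolded Ck_on_Suc_iff_has_derivative]
  note f = Suc.prems(2)[unfolded Ck_on_Suc_iff_has_derivative]
  show ?case
  proof (rule Ck_on_SucI[where f' = "\<lambda>x v.
      \<Sum>b\<in>Basis. (frechet_derivative g (at x) v \<bullet> b) *\<^sub>R frechet_derivative f (at (g x)) b"])
    fix x assume x: "x \<in> S"
    have chain: "((\<lambda>x. f (g x)) has_derivative
        (\<lambda>v. frechet_derivative f (at (g x)) (frechet_derivative g (at x) v))) (at x)"
      by (rule has_derivative_compose) (use f g x assms(2) in auto)
    have d: "f differentiable (at (g x))" using f x assms(2) by (auto simp: differentiable_def)
    show "((\<lambda>x. f (g x)) has_derivative
        (\<lambda>v. \<Sum>b\<in>Basis. (frechet_derivative g (at x) v \<bullet> b) *\<^sub>R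
          frechet_derivative f (at (g x)) b)) (at x)"
      using chain by (simp only: frechet_derivative_Basis_sum[OF d, symmetric])
  next
    fix v
    have "Ck_on k S (\<lambda>x. frechet_derivative g (at x) v \<bullet> b)" for b
      by (rule bounded_bilinear.Ck_on[OF bounded_bilinear_inner]) (use g assms(1) Ck_on_const in auto)
    then show "Ck_on k S (\<lambda>x. \<Sum>b\<in>Basis. (frechet_derivative g (at x) v \<bullet> b) *\<^sub>R
          frechet_derivative f (at (g x)) b)"
      using f Suc.prems(1)
      by (intro Ck_on_sum bounded_bilinear.Ck_on[OF bounded_bilinear_scaleR] Suc.IH assms(1)) (auto dest: Ck_on_SucD)
  qed fact
qed

section \<open>Bump functions\<close>

text \<open>
  For \<open>k = 0\<close> this is the standard smooth function \<open>exp (- 1 / x)\<close>, extended by \<open>0\<close>, all of whose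
  derivatives vanish at the origin. The factor \<open>x\<^sup>-\<^sup>k\<close> makes the family closed under differentiation up to linear combinations.
\<close>

definition exp_recip :: "nat \<Rightarrow> real \<Rightarrow> real"
  where "exp_recip k x = (if x > 0 then inverse x ^ k * exp (- inverse x) else 0)"

lemma exp_recip_tendsto_0: "(exp_recip k \<longlongrightarrow> 0) (at 0)"
proof (rule filterlim_split_at)
  show "(exp_recip k \<longlongrightarrow> 0) (at_left 0)"
    by (rule tendsto_eventually) (auto simp: exp_recip_def eventually_at_filter)
  have "((\<lambda>x. inverse x ^ k / exp (inverse x)) \<longlongrightarrow> 0) (at_right (0::real))"
    by (rule filterlim_compose[OF tendsto_power_div_exp_0 filterlim_inverse_at_top_right])
  then show "(exp_recip k \<longlongrightarrow> 0) (at_right 0)"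
    by (rule Lim_transform_eventually) (auto simp: exp_recip_def exp_minus divide_inverse eventually_at_filter)
qed

text \<open>
  The difference quotient of \<open>exp_recip k\<close> at \<open>0\<close> is \<open>exp_recip (k + 1)\<close>, which tends to \<open>0\<close>.
\<close>

lemma exp_recip_has_derivative:
  "(exp_recip k has_derivative (\<lambda>v. v * (exp_recip (k + 2) x - of_nat k * exp_recip (k + 1) x))) (at x)"
proof -
  consider "x > 0" | "x < 0" | "x = 0" by linarith
  then have "(exp_recip k has_real_derivative exp_recip (k + 2) x - of_nat k * exp_recip (k + 1) x) (at x)"
  proof cases
    case 1
    have pow: "inverse x * inverse x ^ (m - Suc 0) = inverse x ^ m" if "m \<noteq> 0" for m
      using that by (simp add: power_eq_if)
    have "((\<lambda>x. inverse x ^ k * exp (- inverse x)) has_real_derivative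
        exp_recip (k + 2) x - of_nat k * exp_recip (k + 1) x) (at x)"
      using 1 pow[of "k - 1"] by (cases "k \<le> 1"; cases k)
        (auto intro!: derivative_eq_intros simp: exp_recip_def algebra_simps power2_eq_square)
    moreover have "\<forall>\<^sub>F y in nhds x. inverse y ^ k * exp (- inverse y) = exp_recip k y"
      using 1 eventually_nhds_in_open[of "{0<..}" x] by (auto elim!: eventually_mono simp: exp_recip_def)
    ultimately show ?thesis by (rule DERIV_cong_ev[OF refl _ refl, THEN iffD1, rotated])
  next
    case 2
    have "\<forall>\<^sub>F y in nhds x. 0 = exp_recip k y"
      using 2 eventually_nhds_in_open[of "{..<0}" x] by (auto elim!: eventually_mono simp: exp_recip_def)
    moreover have "((\<lambda>_. 0) has_real_derivative exp_recip (k + 2) x - of_nat k * exp_recip (k + 1) x) (at x)"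
      using 2 by (simp add: exp_recip_def)
    ultimately show ?thesis by (rule DERIV_cong_ev[OF refl _ refl, THEN iffD1])
  next
    case 3
    have "(\<lambda>h. (exp_recip k (0 + h) - exp_recip k 0) / h) = exp_recip (Suc k)"
      by (auto simp: exp_recip_def fun_eq_iff divide_simps)
    then show ?thesis using 3 exp_recip_tendsto_0[of "Suc k"]
      by (simp add: DERIV_def exp_recip_def)
  qed
  then show ?thesis unfolding has_field_derivative_def
    by (rule has_derivative_eq_rhs) (simp add: fun_eq_iff mult.commute)
qed

lemma Ck_on_exp_recip: "Ck_on n UNIV (exp_recip k)"
proof (induction n arbitrary: k)
  case 0
  show ?case using exp_recip_has_derivative
    by (auto intro!: continuous_at_imp_continuous_on has_derivative_continuous)
next
  case (Suc n)
  have "Ck_on n UNIV (\<lambda>x. v * (exp_recip (k + 2) x + (- of_nat k) * exp_recip (k + 1) x))" for v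
    by (intro bounded_bilinear.Ck_on[OF bounded_bilinear_mult] Ck_on_add Ck_on_const Suc.IH) auto
  then show ?case
    by (intro Ck_on_SucI[OF _ exp_recip_has_derivative]) auto
qed

text \<open>
  With \<open>g = exp_recip 0\<close>, the function \<open>r(x) = g(\<delta>\<^sup>2 - |x - p|\<^sup>2)\<close> is positive exactly on the open ball.
  It is flattened to the value \<open>1\<close> near \<open>p\<close> by \<open>1 - g(c - r) / g(c)\<close>, which is \<open>1\<close> where \<open>r \<ge> c\<close> and
  \<open>0\<close> where \<open>r = 0\<close>.
\<close>

lemma smooth_bump:
  fixes p :: "'a::euclidean_space"
  assumes "\<delta> > 0"
  obtains b :: "'a \<Rightarrow> real" and T where "\<And>k. Ck_on k UNIV b" "\<And>x. x \<notin> cball p \<delta> \<Longrightarrow> b x = 0"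
    "open T" "p \<in> T" "\<And>x. x \<in> T \<Longrightarrow> b x = 1"
proof -
  let ?g = "exp_recip 0"
  define r where "r x = ?g (\<delta>\<^sup>2 - (x - p) \<bullet> (x - p))" for x
  define c where "c = r p / 2"
  have pos: "?g t > 0" if "t > 0" for t using that by (simp add: exp_recip_def)
  have c: "c > 0" using pos[of "\<delta>\<^sup>2"] assms by (simp add: c_def r_def)
  have "Ck_on k UNIV (\<lambda>x. \<delta>\<^sup>2 + (- 1) * ((x + (- p)) \<bullet> (x + (- p))))" for k
    by (intro bounded_bilinear.Ck_on[OF bounded_bilinear_mult] bounded_bilinear.Ck_on[OF bounded_bilinear_inner]
       Ck_on_add Ck_on_const Ck_on_bounded_linear bounded_linear_ident) auto
  then have r: "Ck_on k UNIV r" for k unfolding r_def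
    by (intro Ck_on_compose[OF _ _ _ Ck_on_exp_recip]) auto
  define b where "b x = 1 + (- 1 / ?g c) * ?g (c + (- 1) * r x)" for x
  have "Ck_on k UNIV b" for k unfolding b_def
    by (intro bounded_bilinear.Ck_on[OF bounded_bilinear_mult]
       Ck_on_add Ck_on_const Ck_on_compose[OF _ _ _ Ck_on_exp_recip] r) auto
  moreover have "b x = 0" if "x \<notin> cball p \<delta>" for x
  proof -
    have "\<delta>\<^sup>2 < (norm (x - p))\<^sup>2" using that assms
      by (intro power_strict_mono) (auto simp: dist_norm norm_minus_commute)
    then have "r x = 0" by (simp add: r_def exp_recip_def power2_norm_eq_inner)
    then show ?thesis using pos[OF c] by (simp add: b_def)
  qed
  moreover have "open {x. c < r x}"
    using r[of 0] by (auto intro!: open_Collect_less)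
  moreover have "p \<in> {x. c < r x}" using c by (simp add: c_def)
  moreover have "b x = 1" if "x \<in> {x. c < r x}" for x
    using that by (simp add: b_def exp_recip_def)
  ultimately show ?thesis using that by blast
qed


section \<open>Subspaces carried along by a linear differential equation\<close>

text \<open>
  A Gronwall inequality for the upper right Dini derivative. If \<open>d\<close> ever exceeded the exponential
  \<open>f(t) = \<epsilon> exp ((K + 1) (t - a))\<close>, consider the last time \<open>\<tau>\<close> with \<open>d \<tau> \<le> f \<tau>\<close>: there \<open>d\<close> grows at
  rate at most \<open>K f + \<epsilon> \<le> (K + 1) f\<close>, whereas \<open>f\<close> grows at least at that rate.
\<close>

lemma Dini_nonpos_forward:
  fixes d :: "real \<Rightarrow> real"
  assumes "a \<le> b" "continuous_on {a..b} d" "d a \<le> 0" "K \<ge> 0"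
    and dini: "\<And>t \<epsilon>. a \<le> t \<Longrightarrow> t < b \<Longrightarrow> \<epsilon> > 0 \<Longrightarrow>
      \<forall>\<^sub>F s in at_right t. d s \<le> d t + (s - t) * (K * d t + \<epsilon>)"
  shows "d b \<le> 0"
proof (rule field_le_epsilon)
  fix e :: real assume "e > 0"
  \<comment> \<open>This choice gives \<open>f\<close> the value \<open>e\<close> at \<open>b\<close>.\<close>
  define \<epsilon> where "\<epsilon> = e * exp (- ((K + 1) * (b - a)))"
  define f where "f t = \<epsilon> * exp ((K + 1) * (t - a))" for t
  have eps: "\<epsilon> > 0" using \<open>e > 0\<close> by (simp add: \<epsilon>_def)
  define S where "S = {t \<in> {a..b}. d t \<le> f t}"
  have "a \<in> S" using assms eps by (simp add: S_def f_def)
  have "continuous_on {a..b} f" unfolding f_def by (intro continuous_intros)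
  then have "closed S" unfolding S_def
    by (intro continuous_closed_preimage_constant continuous_on_closed_Collect_le assms) auto
  have bdd: "bdd_above S" by (auto simp: S_def bdd_above_def)
  define \<tau> where "\<tau> = Sup S"
  have tau: "\<tau> \<in> S" unfolding \<tau>_def
    by (rule closed_contains_Sup) (use \<open>closed S\<close> bdd \<open>a \<in> S\<close> in auto)
  have "\<tau> = b"
  proof (rule ccontr)
    assume "\<tau> \<noteq> b"
    with tau have lt: "a \<le> \<tau>" "\<tau> < b" "d \<tau> \<le> f \<tau>" by (auto simp: S_def)
    have "\<forall>\<^sub>F s in at_right \<tau>. \<tau> < s \<and> s < b"
      using lt by (auto simp: eventually_at_right_field)
    with dini[OF lt(1,2) eps]
    have "\<forall>\<^sub>F s in at_right \<tau>. \<tau> < s \<and> s < b \<and> d s \<le> d \<tau> + (s - \<tau>) * (K * d \<tau> + \<epsilon>)"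
      by eventually_elim auto
    then obtain s where s: "\<tau> < s" "s < b" "d s \<le> d \<tau> + (s - \<tau>) * (K * d \<tau> + \<epsilon>)"
      using eventually_happens' trivial_limit_at_right_real by blast
    have "\<epsilon> \<le> f \<tau>" using eps lt \<open>K \<ge> 0\<close> by (simp add: f_def)
    have "d s \<le> f \<tau> + (s - \<tau>) * (K * f \<tau> + f \<tau>)"
      using s lt \<open>\<epsilon> \<le> f \<tau>\<close> \<open>K \<ge> 0\<close>
      by (smt (verit) mult_left_mono)
    also have "\<dots> = f \<tau> * (1 + (K + 1) * (s - \<tau>))" by (simp add: algebra_simps)
    also have "\<dots> \<le> f \<tau> * exp ((K + 1) * (s - \<tau>))"
      using eps by (intro mult_left_mono exp_ge_add_one_self) (simp add: f_def)
    also have "\<dots> = f s" by (simp add: f_def mult.assoc flip: exp_add) (simp add: algebra_simps)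
    finally have "s \<in> S" using s lt by (simp add: S_def)
    then have "s \<le> \<tau>" unfolding \<tau>_def using bdd by (rule cSup_upper)
    then show False using s by simp
  qed
  then have "d b \<le> f b" using tau by (simp add: S_def)
  also have "\<dots> = e" by (simp add: f_def \<epsilon>_def mult.assoc flip: exp_add)
  finally show "d b \<le> 0 + e" by simp
qed

lemma Dini_nonpos:
  fixes d :: "real \<Rightarrow> real"
  assumes "is_interval J" "continuous_on J d" "K \<ge> 0" 
    and dini: "\<And>t \<epsilon>. t \<in> J \<Longrightarrow> \<epsilon> > 0 \<Longrightarrow>
      \<forall>\<^sub>F s in at t. d s \<le> d t + \<bar>s - t\<bar> * (K * d t + \<epsilon>)"
    and "s \<in> J" "t \<in> J" "d s \<le> 0"
  shows "d t \<le> 0"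
proof (cases "s \<le> t")
  case True
  have sub: "{s..t} \<subseteq> J" using mem_is_interval_1_I[OF assms(1,5,6)] by auto
  show ?thesis
  proof (rule Dini_nonpos_forward[where d = d and K = K, OF True _ assms(7,3)])
    show "continuous_on {s..t} d" using sub assms(2) continuous_on_subset by blast
    fix r \<epsilon> :: real assume r: "s \<le> r" "r < t" "\<epsilon> > 0"
    then have "r \<in> J" using sub by auto
    then have "\<forall>\<^sub>F q in at_right r. d q \<le> d r + \<bar>q - r\<bar> * (K * d r + \<epsilon>)"
      using dini[of r \<epsilon>] r by (auto simp: eventually_at_split)
    moreover have "\<forall>\<^sub>F q in at_right r. q > r" by (simp add: eventually_at_right_less)
    ultimately show "\<forall>\<^sub>F q in at_right r. d q \<le> d r + (q - r) * (K * d r + \<epsilon>)"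
      by eventually_elim simp
  qed
next
  case False
  then have le: "- s \<le> - t" by simp
  have sub: "{t..s} \<subseteq> J" using mem_is_interval_1_I[OF assms(1,6,5)] by auto
  define d' where "d' r = d (- r)" for r
  have "d' (- t) \<le> 0"
  proof (rule Dini_nonpos_forward[where d = d' and K = K, OF le _ _ assms(3)])
    have "continuous_on {t..s} d" using sub assms(2) continuous_on_subset by blast
    then show "continuous_on {- s..- t} d'" unfolding d'_def
      by (rule continuous_on_compose2) (auto intro: continuous_intros)
    show "d' (- s) \<le> 0" using assms(7) by (simp add: d'_def)
    fix r \<epsilon> :: real assume r: "- s \<le> r" "r < - t" "\<epsilon> > 0"
    then have "- r \<in> J" using sub by auto
    then have "\<forall>\<^sub>F q in at_left (- r). d q \<le> d (- r) + \<bar>q - (- r)\<bar> * (K * d (- r) + \<epsilon>)"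
      using dini[of "- r" \<epsilon>] r by (auto simp: eventually_at_split)
    moreover have "\<forall>\<^sub>F q in at_left (- r). q < - r" by (auto simp: eventually_at_filter)
    ultimately have "\<forall>\<^sub>F q in at_left (- r). d q \<le> d (- r) + (- q - r) * (K * d (- r) + \<epsilon>)"
      by eventually_elim simp
    then show "\<forall>\<^sub>F q in at_right r. d' q \<le> d' r + (q - r) * (K * d' r + \<epsilon>)"
      by (simp add: at_left_minus eventually_filtermap d'_def)
  qed
  then show ?thesis by (simp add: d'_def)
qed

text \<open>
  The distance from a point to a moving span is continuous where the spanning vectors are linearly
  independent; otherwise the dimension may drop. With functionals \<open>\<beta>\<^sub>i\<close> dual to the vectors
  \<open>y\<^sub>i(t0)\<close>, the linear map \<open>\<Phi>\<^sub>t w = w + (\<Sum>i. \<beta>\<^sub>i(w) (y\<^sub>i(t) - y\<^sub>i(t0)))\<close> takes the span at time \<open>t0\<close> to the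
  one at time \<open>t\<close> and tends to the identity as \<open>t\<close> tends to \<open>t0\<close>. Moving nearest points with \<open>\<Phi>\<^sub>t\<close>
  compares the two distances.
\<close>

lemma isCont_infdist_span:
  fixes u :: "real \<Rightarrow> 'a::euclidean_space" and y :: "nat \<Rightarrow> real \<Rightarrow> 'a"
  assumes u: "isCont u t0" and y: "\<And>i. i < r \<Longrightarrow> isCont (y i) t0"
    and ind: "independent ((\<lambda>i. y i t0) ` {..<r})" "inj_on (\<lambda>i. y i t0) {..<r}"
  shows "isCont (\<lambda>t. infdist (u t) (span ((\<lambda>i. y i t) ` {..<r}))) t0"
proof -
  let ?E = "\<lambda>t. span ((\<lambda>i. y i t) ` {..<r})"
  define d where "d t = infdist (u t) (?E t)" for t
  have clE: "closed (?E t)" "?E t \<noteq> {}" for t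
    using closed_subspace subspace_span span_zero by blast+
  have near: "\<exists>v\<in>?E t. d t = norm (u t - v)" for t
    using infdist_attains_inf[OF clE, of t "u t"] unfolding d_def dist_norm by blast
  have d_le: "d t \<le> norm (u t - v)" if "v \<in> ?E t" for t v
    using infdist_le[OF that, of "u t"] by (simp add: d_def dist_norm)
  have dual_ex: "\<exists>g. linear g \<and> (\<forall>j<r. g (y j t0) = (if i = j then 1 else 0::real))" for i
  proof -
    obtain g where "linear g" "\<forall>x\<in>(\<lambda>i. y i t0) ` {..<r}. g x = (if x = y i t0 \<and> i < r then 1 else 0::real)"
      using linear_independent_extend[OF ind(1), of "\<lambda>x. if x = y i t0 \<and> i < r then 1 else 0"] by blast
    moreover have "(y j t0 = y i t0 \<and> i < r) = (i = j)" if "j < r" for j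
      using that ind(2) by (auto simp: inj_on_def)
    ultimately show ?thesis by auto
  qed
  define \<beta> where "\<beta> i = (SOME g. linear g \<and> (\<forall>j<r. g (y j t0) = (if i = j then 1 else 0::real)))" for i
  have \<beta>: "linear (\<beta> i) \<and> (\<forall>j<r. \<beta> i (y j t0) = (if i = j then 1 else 0))" for i
    unfolding \<beta>_def by (rule someI_ex[OF dual_ex])
  then have lin: "linear (\<beta> i)" for i by blast
  have dual: "\<beta> i (y j t0) = (if i = j then 1 else 0)" if "j < r" for i j using \<beta> that by blast
  define \<Phi> where "\<Phi> t w = w + (\<Sum>i<r. \<beta> i w *\<^sub>R (y i t - y i t0))" for t w
  define \<theta> where "\<theta> t = (\<Sum>i<r. onorm (\<beta> i) * norm (y i t - y i t0))" for t
  have lin_\<Phi>: "linear (\<Phi> t)" for t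
    unfolding \<Phi>_def using lin
    by (intro linear_compose_add linear_ident linear_compose_sum ballI)
       (auto intro!: linearI simp: linear_add linear_scale scaleR_add_left)
  have "\<Phi> t (y j t0) = y j t" if "j < r" for j t
  proof -
    have "(\<Sum>i<r. \<beta> i (y j t0) *\<^sub>R (y i t - y i t0)) = (\<Sum>i<r. if i = j then y i t - y i t0 else 0)"
      using that by (intro sum.cong) (auto simp: dual)
    then show ?thesis using that by (simp add: \<Phi>_def)
  qed
  then have "(\<lambda>i. y i t) ` {..<r} = \<Phi> t ` (\<lambda>i. y i t0) ` {..<r}" for t
    by (auto simp: image_image)
  then have E: "?E t = \<Phi> t ` ?E t0" for t
    using linear_span_image[OF lin_\<Phi>] by metis
  have \<Phi>_near: "norm (\<Phi> t w - w) \<le> \<theta> t * norm w" for t w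
  proof -
    have "norm (\<beta> i w *\<^sub>R (y i t - y i t0)) \<le> onorm (\<beta> i) * norm (y i t - y i t0) * norm w" for i
      using onorm[of "\<beta> i" w] lin[of i] mult_right_mono[of "norm (\<beta> i w)" "onorm (\<beta> i) * norm w" "norm (y i t - y i t0)"]
      by (simp add: linear_conv_bounded_linear mult_ac)
    then have "norm (\<Sum>i<r. \<beta> i w *\<^sub>R (y i t - y i t0)) \<le> (\<Sum>i<r. onorm (\<beta> i) * norm (y i t - y i t0) * norm w)"
      by (intro sum_norm_le) auto
    then show ?thesis by (simp add: \<Phi>_def \<theta>_def sum_distrib_right)
  qed
  have \<theta>0: "(\<theta> \<longlongrightarrow> 0) (at t0)"
  proof -
    have "((\<lambda>t. \<Sum>i<r. onorm (\<beta> i) * norm (y i t - y i t0)) \<longlongrightarrow> (\<Sum>i<r. onorm (\<beta> i) * norm (y i t0 - y i t0))) (at t0)"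
      using y unfolding isCont_def by (intro tendsto_intros) auto
    then show ?thesis by (simp add: \<theta>_def[abs_def])
  qed
  \<comment> \<open>A nearest point of the subspace cannot be far away, since \<open>0\<close> is a competitor.\<close>
  have norm_near: "norm v \<le> 2 * norm (u t)" if "d t = norm (u t - v)" for t v
    using that d_le[OF span_zero, of t] norm_triangle_ineq2[of v "u t"] by (auto simp: norm_minus_commute)
  have bound: "\<bar>d t - d t0\<bar> \<le> norm (u t - u t0) + 4 * \<theta> t * (norm (u t) + norm (u t0))"
    if th: "\<theta> t \<le> 1 / 2" "\<theta> t \<ge> 0" for t
  proof -
    obtain v where v: "v \<in> ?E t" "d t = norm (u t - v)" using near by blast
    then obtain w where w: "w \<in> ?E t0" "v = \<Phi> t w" using v(1) unfolding E[of t] by blast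
    have "norm w \<le> 2 * norm v"
      using \<Phi>_near[of t w] norm_triangle_ineq2[of w v] mult_right_mono[OF th(1), of "norm w"] w
      by (auto simp: norm_minus_commute)
    then have "norm w \<le> 4 * norm (u t)" using norm_near[OF v(2)] by simp
    then have 1: "norm (v - w) \<le> 4 * \<theta> t * norm (u t)"
      using \<Phi>_near[of t w] mult_left_mono[of "norm w" "4 * norm (u t)" "\<theta> t"] th w by simp
    have "d t0 \<le> norm (u t0 - w)" using w by (intro d_le)
    also have "\<dots> \<le> norm (u t - u t0) + d t + norm (v - w)"
      unfolding v(2) by norm
    finally have a: "d t0 - d t \<le> norm (u t - u t0) + 4 * \<theta> t * norm (u t)" using 1 by simp
    obtain w0 where w0: "w0 \<in> ?E t0" "d t0 = norm (u t0 - w0)" using near by blast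
    have 2: "norm (\<Phi> t w0 - w0) \<le> 4 * \<theta> t * norm (u t0)"
      using \<Phi>_near[of t w0] mult_left_mono[OF norm_near[OF w0(2)], of "\<theta> t"] th
        mult_nonneg_nonneg[of "\<theta> t" "norm (u t0)"] norm_ge_zero[of "u t0"] by argo
    have "\<Phi> t w0 \<in> ?E t" using w0(1) unfolding E[of t] by (rule imageI)
    then have "d t \<le> norm (u t - \<Phi> t w0)" by (rule d_le)
    also have "\<dots> \<le> norm (u t - u t0) + d t0 + norm (\<Phi> t w0 - w0)"
      unfolding w0(2) by norm
    finally have b: "d t - d t0 \<le> norm (u t - u t0) + 4 * \<theta> t * norm (u t0)" using 2 by simp
    have "0 \<le> \<theta> t * norm (u t)" "0 \<le> \<theta> t * norm (u t0)" using th by auto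
    then show ?thesis using a b by (simp add: algebra_simps abs_le_iff)
  qed
  have "((\<lambda>t. norm (u t - u t0) + 4 * \<theta> t * (norm (u t) + norm (u t0))) \<longlongrightarrow>
      norm (u t0 - u t0) + 4 * 0 * (norm (u t0) + norm (u t0))) (at t0)"
    using u \<theta>0 unfolding isCont_def by (intro tendsto_intros)
  then have lim: "((\<lambda>t. norm (u t - u t0) + 4 * \<theta> t * (norm (u t) + norm (u t0))) \<longlongrightarrow> 0) (at t0)"
    by simp
  have \<theta>_nonneg: "\<theta> t \<ge> 0" for t unfolding \<theta>_def
    using lin by (auto intro!: sum_nonneg mult_nonneg_nonneg onorm_pos_le simp: linear_conv_bounded_linear)
  have "\<forall>\<^sub>F t in at t0. \<theta> t < 1 / 2" using \<theta>0 by (rule order_tendstoD) simp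
  then have "\<forall>\<^sub>F t in at t0. norm (d t - d t0) \<le> norm (u t - u t0) + 4 * \<theta> t * (norm (u t) + norm (u t0))"
    by eventually_elim (use bound \<theta>_nonneg in simp)
  then have "((\<lambda>t. d t - d t0) \<longlongrightarrow> 0) (at t0)"
    using lim by (rule Lim_null_comparison)
  then show ?thesis unfolding isCont_def d_def using Lim_null by blast
qed

text \<open>
  Let \<open>v = (\<Sum>i. b\<^sub>i y\<^sub>i(t))\<close> be the point of \<open>E t\<close> nearest to \<open>u t\<close>. It can be continued to a curve \<open>z\<close>
  inside the moving subspace with \<open>z'(t) = L t v\<close>: the coefficients \<open>b\<^sub>i\<close> are changed linearly in time
  so as to cancel the terms \<open>e\<^sub>i\<close>. Then \<open>u - z\<close> has derivative \<open>L t (u t - v)\<close>, of norm at most \<open>K\<close>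
  times the distance at time \<open>t\<close>, and the distance satisfies the hypothesis of \<open>Dini_nonpos\<close>.
\<close>

lemma invariant_span_along_linear_flow:
  fixes u :: "real \<Rightarrow> 'a::euclidean_space" and y :: "nat \<Rightarrow> real \<Rightarrow> 'a" and r :: nat
  defines "E \<equiv> \<lambda>t. span ((\<lambda>i. y i t) ` {..<r})"
  assumes J: "is_interval J" and lin: "\<And>t. t \<in> J \<Longrightarrow> linear (L t)"
    and K: "K \<ge> 0" "\<And>t v. t \<in> J \<Longrightarrow> norm (L t v) \<le> K * norm v"
    and u: "\<And>t. t \<in> J \<Longrightarrow> (u has_vector_derivative L t (u t)) (at t)"
    and y: "\<And>t i. t \<in> J \<Longrightarrow> i < r \<Longrightarrow> (y i has_vector_derivative L t (y i t) + e i t) (at t)"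
    and e: "\<And>t i. t \<in> J \<Longrightarrow> i < r \<Longrightarrow> e i t \<in> E t"
    and ind: "\<And>t. t \<in> J \<Longrightarrow> independent ((\<lambda>i. y i t) ` {..<r})"
      "\<And>t. t \<in> J \<Longrightarrow> inj_on (\<lambda>i. y i t) {..<r}"
    and st: "s \<in> J" "t \<in> J" "u s \<in> E s"
  shows "u t \<in> E t"
proof -
  define d where "d t = infdist (u t) (E t)" for t
  have clE: "closed (E t)" "E t \<noteq> {}" for t 
    unfolding E_def using closed_subspace subspace_span span_zero by blast+
  have E_repr: "\<exists>c. v = (\<Sum>i<r. c i *\<^sub>R y i t)" if "v \<in> E t" "t \<in> J" for v t
  proof -
    have "v \<in> range (\<lambda>c. \<Sum>w\<in>(\<lambda>i. y i t) ` {..<r}. c w *\<^sub>R w)"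
      using that(1) unfolding E_def span_finite[OF finite_imageI[OF finite_lessThan]] .
    then obtain c where "v = (\<Sum>w\<in>(\<lambda>i. y i t) ` {..<r}. c w *\<^sub>R w)"
      by (rule rangeE)
    also have "\<dots> = (\<Sum>i<r. c (y i t) *\<^sub>R y i t)"
      using ind(2)[OF that(2)] by (simp add: sum.reindex)
    finally show ?thesis by (rule exI[where x = "\<lambda>i. c (y i t)"])
  qed
  have "d t \<le> 0"
  proof (rule Dini_nonpos[where d = d and K = K, OF J _ K(1) _ st(1,2)])
    show "d s \<le> 0" using st(3) by (simp add: d_def)
    show "continuous_on J d"
      unfolding d_def[abs_def] E_def
      by (intro continuous_at_imp_continuous_on ballI isCont_infdist_span ind)
         (use u y has_vector_derivative_continuous in blast)+
  next
    fix t \<epsilon> :: real assume t: "t \<in> J" and "\<epsilon> > 0"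
    obtain v where v: "v \<in> E t" "d t = norm (u t - v)"
      using infdist_attains_inf[OF clE] unfolding d_def dist_norm by metis
    obtain b where b: "v = (\<Sum>i<r. b i *\<^sub>R y i t)" using E_repr[OF v(1) t] by blast
    have "(\<Sum>i<r. b i *\<^sub>R e i t) \<in> E t"
      using e[OF t] unfolding E_def by (intro span_sum span_scale) auto
    then obtain c where c: "(\<Sum>i<r. b i *\<^sub>R e i t) = (\<Sum>i<r. c i *\<^sub>R y i t)" using E_repr t by blast
    define z where "z s = (\<Sum>i<r. (b i - (s - t) * c i) *\<^sub>R y i s)" for s
    have "(z has_vector_derivative (\<Sum>i<r. (b i - (t - t) * c i) *\<^sub>R (L t (y i t) + e i t) + (- c i) *\<^sub>R y i t)) (at t)"
      unfolding z_def[abs_def] using y[OF t]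
      by (intro has_vector_derivative_sum has_vector_derivative_scaleR) (auto intro!: derivative_eq_intros)
    moreover have "(\<Sum>i<r. (b i - (t - t) * c i) *\<^sub>R (L t (y i t) + e i t) + (- c i) *\<^sub>R y i t) = L t v"
      using c unfolding b linear_sum[OF lin[OF t]] linear_scale[OF lin[OF t]]
      by (simp add: sum.distrib scaleR_add_right sum_subtractf)
    ultimately have "((\<lambda>s. u s - z s) has_vector_derivative L t (u t) - L t v) (at t)"
      using u[OF t] by (auto intro: has_vector_derivative_diff)
    moreover have zt: "z t = v" by (simp add: z_def b)
    ultimately have "((\<lambda>s. u s - z s) has_vector_derivative L t (u t - v)) (at t)"
      by (simp add: linear_diff[OF lin[OF t]])
    then have "\<forall>\<^sub>F s in at t. norm ((u s - z s) - (u t - z t) - (s - t) *\<^sub>R L t (u t - v)) \<le> \<epsilon> * norm (s - t)"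
      unfolding has_vector_derivative_def has_derivative_within_alt2 using \<open>\<epsilon> > 0\<close> by blast
    then show "\<forall>\<^sub>F s in at t. d s \<le> d t + \<bar>s - t\<bar> * (K * d t + \<epsilon>)"
    proof eventually_elim
      case (elim s)
      have "z s \<in> E s" unfolding z_def E_def by (intro span_sum span_scale span_base) auto
      have tri: "norm p \<le> norm q + norm w + norm (p - q - w)" for p q w :: 'a by norm
      from \<open>z s \<in> E s\<close> have "d s \<le> norm (u s - z s)" using infdist_le[of "z s"] by (simp add: d_def dist_norm)
      also have "\<dots> \<le> norm (u t - z t) + norm ((s - t) *\<^sub>R L t (u t - v)) + \<epsilon> * norm (s - t)"
        using elim tri[of "u s - z s" "u t - z t" "(s - t) *\<^sub>R L t (u t - v)"] by linarith
      also have "norm ((s - t) *\<^sub>R L t (u t - v)) \<le> \<bar>s - t\<bar> * (K * d t)"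
        using K(2)[OF t, of "u t - v"] by (simp add: v(2) mult_left_mono)
      finally show ?case by (simp add: zt v(2) algebra_simps)
    qed
  qed
  then have "infdist (u t) (E t) = 0" unfolding d_def using infdist_nonneg[of "u t" "E t"] by linarith
  then show ?thesis using in_closed_iff_infdist_zero[OF clE] by blast
qed


section \<open>Smooth functions and tangent vectors in a chart\<close>

locale manifold =
  fixes \<A> :: "('m::{t2_space, second_countable_topology}, 'e::euclidean_space) chart set"
  assumes atlas: "smooth_atlas \<A>"

locale manifold_chart = manifold \<A>
  for \<A> :: "('m::{t2_space, second_countable_topology}, 'e::euclidean_space) chart set" +
  fixes U :: "'m set" and \<phi> :: "'m \<Rightarrow> 'e"
  assumes chart: "(U, \<phi>) \<in> \<A>"
begin

abbreviation param where "param \<equiv> inv_into U \<phi>"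

lemma homeomorphism_chart: "homeomorphism U (\<phi> ` U) \<phi> param"
  and open_domain: "open U" and open_range: "open (\<phi> ` U)"
  using chart atlas by (auto simp: smooth_atlas_def is_chart_def)

lemma param_chart [simp]: "x \<in> U \<Longrightarrow> param (\<phi> x) = x"
  using homeomorphism_apply1[OF homeomorphism_chart] .

lemma chart_param [simp]: "p \<in> \<phi> ` U \<Longrightarrow> \<phi> (param p) = p"
  by (rule f_inv_into_f)

lemma param_in [simp]: "p \<in> \<phi> ` U \<Longrightarrow> param p \<in> U"
  by (rule inv_into_into)

lemma open_image: "W \<subseteq> U \<Longrightarrow> open W \<Longrightarrow> open (\<phi> ` W)"
  using homeomorphism_imp_open_map[OF homeomorphism_chart, of W] open_range
  by (simp add: openin_open_eq open_domain)

lemma open_preimage: "open T \<Longrightarrow> open (U \<inter> \<phi> -` T)"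
  by (rule continuous_open_preimage[OF homeomorphism_cont1[OF homeomorphism_chart] open_domain])

lemma Ck_on_smooth_function:
  "f \<in> smooth_functions \<A> \<Longrightarrow> Ck_on k (\<phi> ` U) (f \<circ> param)"
  using chart by (auto simp: smooth_functions_def smooth_on_def)

lemma Ck_on_transition:
  "(V, \<kappa>) \<in> \<A> \<Longrightarrow> Ck_on k (\<kappa> ` (V \<inter> U)) (\<phi> \<circ> inv_into V \<kappa>)"
  using atlas chart by (fastforce simp: smooth_atlas_def smooth_on_def)

lemma differentiable_smooth_function:
  "f \<in> smooth_functions \<A> \<Longrightarrow> x \<in> U \<Longrightarrow> (f \<circ> param) differentiable (at (\<phi> x))"
  using Ck_on_smooth_function[of f "Suc 0"] by (simp add: Ck_on.simps(2))

lemma coord_tvec_eq: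
  "f \<in> smooth_functions \<A> \<Longrightarrow>
    coord_tvec \<A> (U, \<phi>) x u f = frechet_derivative (f \<circ> param) (at (\<phi> x)) u"
  by (simp add: coord_tvec_def)

text \<open>
  Locality of tangent vectors: they see only the germ of a smooth function at the base point.
\<close>

lemma coord_tvec_local:
  assumes "f \<in> smooth_functions \<A>" "open W" "W \<subseteq> U" "x \<in> W" "\<And>y. y \<in> W \<Longrightarrow> f y = h (\<phi> y)"
  shows "coord_tvec \<A> (U, \<phi>) x u f = frechet_derivative h (at (\<phi> x)) u"
proof -
  have "frechet_derivative (f \<circ> param) (at (\<phi> x)) = frechet_derivative h (at (\<phi> x))"
    by (rule frechet_derivative_transform_within_open[of _ _ "\<phi> ` W"])
       (use assms differentiable_smooth_function open_image in auto)
  then show ?thesis using assms(1) by (simp add: coord_tvec_eq)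
qed

text \<open>
  The preimage of the compact set \<open>C\<close> is compact, hence closed as the manifold is Hausdorff. So every
  other chart domain \<open>V\<close> is covered by two open sets, \<open>V \<inter> U\<close> and the complement of the preimage of
  \<open>C\<close>, and on each of them the function is visibly smooth.
\<close>

lemma extension_by_zero_smooth:
  assumes h: "\<And>k. Ck_on k (\<phi> ` U) h"
    and C: "compact C" "C \<subseteq> \<phi> ` U" and zero: "\<And>p. p \<in> \<phi> ` U - C \<Longrightarrow> h p = 0"
  shows "(\<lambda>y. if y \<in> U then h (\<phi> y) else 0) \<in> smooth_functions \<A>" (is "?F \<in> _")
proof -
  have "Ck_on k (\<kappa> ` V) (?F \<circ> inv_into V \<kappa>)" if V: "(V, \<kappa>) \<in> \<A>" for V \<kappa> k
  proof -
    interpret v: manifold_chart \<A> V \<kappa> by unfold_locales (rule V)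
    let ?K = "param ` C"
    have "continuous_on C param"
      using homeomorphism_cont2[OF homeomorphism_chart] C(2) continuous_on_subset by blast
    then have "closed ?K" using C(1) compact_continuous_image compact_imp_closed by blast
    have K: "?K \<subseteq> U" using C(2) param_in by blast
    have o1: "open (\<kappa> ` (V \<inter> U))"
      by (intro v.open_image open_Int v.open_domain open_domain) auto
    have o2: "open (\<kappa> ` (V - ?K))"
      using v.open_domain \<open>closed ?K\<close> by (intro v.open_image open_Diff) auto
    have "Ck_on k (\<kappa> ` (V \<inter> U)) (\<lambda>p. h ((\<phi> \<circ> inv_into V \<kappa>) p))"
      by (rule Ck_on_compose[OF o1 _ Ck_on_transition[OF V] h]) auto
    then have "Ck_on k (\<kappa> ` (V \<inter> U)) (?F \<circ> inv_into V \<kappa>)"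
      by (rule Ck_on_cong[OF o1, rotated]) auto
    moreover have "Ck_on k (\<kappa> ` (V - ?K)) (?F \<circ> inv_into V \<kappa>)"
    proof (rule Ck_on_cong[OF o2 _ Ck_on_const[OF o2, of _ 0]])
      fix p assume "p \<in> \<kappa> ` (V - ?K)"
      then obtain y where y: "y \<in> V" "y \<notin> ?K" "p = \<kappa> y" by auto
      have "h (\<phi> y) = 0" if "y \<in> U"
      proof (rule zero)
        have "\<phi> y \<notin> C" using y(2) param_chart[OF that] by (metis imageI)
        then show "\<phi> y \<in> \<phi> ` U - C" using that by simp
      qed
      then show "0 = (?F \<circ> inv_into V \<kappa>) p" using y by simp
    qed
    ultimately have "Ck_on k (\<kappa> ` (V \<inter> U) \<union> \<kappa> ` (V - ?K)) (?F \<circ> inv_into V \<kappa>)"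
      by (rule Ck_on_Un[OF o1 o2])
    moreover have "V \<inter> U \<union> (V - ?K) = V" using K by auto
    ultimately show ?thesis by (simp flip: image_Un)
  qed
  then show ?thesis by (auto simp: smooth_functions_def smooth_on_def)
qed

text \<open>
  The last conclusion says that multiplication by \<open>\<rho>\<close> makes any smooth function on the coordinate
  domain extend by zero to the manifold; smoothness of \<open>\<rho>\<close> is the case of the constant \<open>1\<close>.
\<close>

lemma cutoff:
  assumes "x0 \<in> U" "open N" "x0 \<in> N"
  obtains \<rho> W where "\<rho> \<in> smooth_functions \<A>" "open W" "x0 \<in> W" "W \<subseteq> U \<inter> N"
    "\<And>y. y \<in> W \<Longrightarrow> \<rho> y = 1" "\<And>y. y \<notin> N \<Longrightarrow> \<rho> y = 0"
    "\<forall>h. smooth_on (\<phi> ` U) h \<longrightarrow> (\<lambda>y. if y \<in> U then \<rho> y * h (\<phi> y) else 0) \<in> smooth_functions \<A>"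
proof -
  have "open (\<phi> ` (U \<inter> N))" using assms open_domain by (intro open_image) auto
  moreover have "\<phi> x0 \<in> \<phi> ` (U \<inter> N)" using assms by simp
  ultimately have "\<exists>\<delta>>0. cball (\<phi> x0) \<delta> \<subseteq> \<phi> ` (U \<inter> N)"
    by (simp only: open_contains_cball_eq)
  then obtain \<delta> where \<delta>: "\<delta> > 0" "cball (\<phi> x0) \<delta> \<subseteq> \<phi> ` (U \<inter> N)" by blast
  obtain b T where b: "\<And>k. Ck_on k UNIV b" "\<And>p. p \<notin> cball (\<phi> x0) \<delta> \<Longrightarrow> b p = (0::real)"
    "open T" "\<phi> x0 \<in> T" "\<And>p. p \<in> T \<Longrightarrow> b p = 1"
    by (rule smooth_bump[OF \<delta>(1), of "\<phi> x0"]) (rule that)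
  define \<rho> where "\<rho> y = (if y \<in> U then b (\<phi> y) else 0)" for y
  have ext: "(\<lambda>y. if y \<in> U then \<rho> y * h (\<phi> y) else 0) \<in> smooth_functions \<A>"
    if "smooth_on (\<phi> ` U) h" for h
  proof -
    have h: "Ck_on k (\<phi> ` U) h" for k using that by (simp add: smooth_on_def)
    have "(\<lambda>y. if y \<in> U then b (\<phi> y) * h (\<phi> y) else 0) \<in> smooth_functions \<A>"
    proof (rule extension_by_zero_smooth[where h = "\<lambda>p. b p * h p" and C = "cball (\<phi> x0) \<delta>"])
      show "Ck_on k (\<phi> ` U) (\<lambda>p. b p * h p)" for k
        by (rule bounded_bilinear.Ck_on[OF bounded_bilinear_mult open_range Ck_on_subset[OF b(1)] h]) simp
    qed (use \<delta> b(2) in auto)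
    then show ?thesis by (simp add: \<rho>_def cong: if_cong)
  qed
  have "\<rho> \<in> smooth_functions \<A>"
    using ext[of "\<lambda>_. 1"] Ck_on_const[OF open_range, of _ "1 :: real"]
    by (simp add: smooth_on_def \<rho>_def[abs_def] cong: if_cong)
  moreover have "open (U \<inter> \<phi> -` T \<inter> N)"
    using open_preimage[OF b(3)] assms(2) by (rule open_Int)
  moreover have "\<rho> y = 0" if "y \<notin> N" for y
  proof -
    have "\<phi> y \<notin> cball (\<phi> x0) \<delta>" if "y \<in> U"
    proof
      assume "\<phi> y \<in> cball (\<phi> x0) \<delta>"
      then obtain z where "z \<in> U \<inter> N" "\<phi> y = \<phi> z" using \<delta>(2) by auto
      then show False using that \<open>y \<notin> N\<close> param_chart by (metis IntE)
    qed
    then show ?thesis using b(2) by (simp add: \<rho>_def)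
  qed
  ultimately show ?thesis
    using ext assms b(4,5) by (intro that[of \<rho> "U \<inter> \<phi> -` T \<inter> N"]) (auto simp: \<rho>_def)
qed

text \<open>
  Global smooth functions that agree with the linear functions of the coordinates near a given
  point. Tangent vectors are evaluated on them to recover their components.
\<close>

lemma coordinate_functions:
  assumes "x0 \<in> U"
  obtains f W where "open W" "x0 \<in> W" "W \<subseteq> U" "\<And>e. f e \<in> smooth_functions \<A>"
    "\<And>e y. y \<in> W \<Longrightarrow> f e y = \<phi> y \<bullet> e"
proof -
  obtain \<rho> W where "\<rho> \<in> smooth_functions \<A>"
    and W: "open W" "x0 \<in> W" "W \<subseteq> U \<inter> UNIV" "\<And>y. y \<in> W \<Longrightarrow> \<rho> y = 1"
    and "\<And>y. y \<notin> UNIV \<Longrightarrow> \<rho> y = 0"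
    and ext: "\<forall>h. smooth_on (\<phi> ` U) h \<longrightarrow> (\<lambda>y. if y \<in> U then \<rho> y * h (\<phi> y) else 0) \<in> smooth_functions \<A>"
    by (rule cutoff[OF assms open_UNIV UNIV_I]) (rule that)
  have "(\<lambda>y. if y \<in> U then \<rho> y * (\<phi> y \<bullet> e) else 0) \<in> smooth_functions \<A>" for e
    by (rule ext[rule_format, of "\<lambda>p. p \<bullet> e"])
       (simp add: smooth_on_def Ck_on_bounded_linear[OF open_range bounded_linear_inner_left])
  then show ?thesis
    using W by (intro that[of W "\<lambda>e y. if y \<in> U then \<rho> y * (\<phi> y \<bullet> e) else 0"]) auto
qed

lemma coord_tvec_coordinate:
  assumes "f \<in> smooth_functions \<A>" "open W" "W \<subseteq> U" "x \<in> W" "\<And>y. y \<in> W \<Longrightarrow> f y = \<phi> y \<bullet> e"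
  shows "coord_tvec \<A> (U, \<phi>) x u f = u \<bullet> e"
proof -
  have "((\<lambda>p. p \<bullet> e) has_derivative (\<lambda>v. v \<bullet> e)) (at (\<phi> x))"
    by (intro bounded_linear_imp_has_derivative bounded_linear_inner_left)
  then have "frechet_derivative (\<lambda>p. p \<bullet> e) (at (\<phi> x)) = (\<lambda>v. v \<bullet> e)"
    by (rule frechet_derivative_at[symmetric])
  then show ?thesis using coord_tvec_local[of f W x "\<lambda>p. p \<bullet> e", OF assms] by simp
qed

lemma linear_coord_tvec:
  assumes "x \<in> U" shows "linear (coord_tvec \<A> (U, \<phi>) x)"
proof (rule linearI)
  show "coord_tvec \<A> (U, \<phi>) x (u + v) = coord_tvec \<A> (U, \<phi>) x u + coord_tvec \<A> (U, \<phi>) x v" for u v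
  proof
    fix f
    show "coord_tvec \<A> (U, \<phi>) x (u + v) f = (coord_tvec \<A> (U, \<phi>) x u + coord_tvec \<A> (U, \<phi>) x v) f"
    proof (cases "f \<in> smooth_functions \<A>")
      case True
      then show ?thesis
        using linear_add[OF linear_frechet_derivative[OF differentiable_smooth_function[OF True assms]]]
        by (simp add: coord_tvec_eq)
    qed (simp add: coord_tvec_def)
  qed
  show "coord_tvec \<A> (U, \<phi>) x (c *\<^sub>R u) = c *\<^sub>R coord_tvec \<A> (U, \<phi>) x u" for c u
  proof
    fix f
    show "coord_tvec \<A> (U, \<phi>) x (c *\<^sub>R u) f = (c *\<^sub>R coord_tvec \<A> (U, \<phi>) x u) f"
    proof (cases "f \<in> smooth_functions \<A>")
      case True
      then show ?thesis
        using linear_scale[OF linear_frechet_derivative[OF differentiable_smooth_function[OF True assms]]]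
        by (simp add: coord_tvec_eq scaleR_fun_def)
    qed (simp add: coord_tvec_def scaleR_fun_def)
  qed
qed

lemma inj_coord_tvec:
  assumes "x \<in> U" shows "inj (coord_tvec \<A> (U, \<phi>) x)"
proof (rule injI)
  fix u v assume eq: "coord_tvec \<A> (U, \<phi>) x u = coord_tvec \<A> (U, \<phi>) x v"
  obtain f W where W: "open W" "x \<in> W" "W \<subseteq> U" "\<And>e. f e \<in> smooth_functions \<A>"
    "\<And>e y. y \<in> W \<Longrightarrow> f e y = \<phi> y \<bullet> e"
    by (rule coordinate_functions[OF assms]) (rule that)
  have "coord_tvec \<A> (U, \<phi>) x w (f e) = w \<bullet> e" for w e
    by (rule coord_tvec_coordinate[OF W(4,1,3,2,5)])
  then have "u \<bullet> e = v \<bullet> e" for e using eq by metis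
  then show "u = v" by (rule euclidean_eqI)
qed

lemma coord_tvec_change_chart:
  assumes "(V, \<kappa>) \<in> \<A>" "x \<in> U" "x \<in> V"
  shows "\<exists>u'. coord_tvec \<A> (V, \<kappa>) x u = coord_tvec \<A> (U, \<phi>) x u'"
proof -
  interpret v: manifold_chart \<A> V \<kappa> by unfold_locales (rule assms(1))
  let ?t = "\<phi> \<circ> inv_into V \<kappa>"
  let ?W = "V \<inter> U"
  have oW: "open ?W" using v.open_domain open_domain by (rule open_Int)
  have "Ck_on (Suc 0) (\<kappa> ` ?W) ?t"
    by (rule Ck_on_transition[OF assms(1)])
  then have "?t differentiable (at (\<kappa> x))" using assms(2,3) by (simp add: Ck_on.simps(2))
  then have t: "(?t has_derivative frechet_derivative ?t (at (\<kappa> x))) (at (\<kappa> x))"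
    by (simp add: frechet_derivative_works)
  have "coord_tvec \<A> (V, \<kappa>) x u f = coord_tvec \<A> (U, \<phi>) x (frechet_derivative ?t (at (\<kappa> x)) u) f" for f
  proof (cases "f \<in> smooth_functions \<A>")
    case True
    have f: "((f \<circ> param) has_derivative frechet_derivative (f \<circ> param) (at (?t (\<kappa> x)))) (at (?t (\<kappa> x)))"
      using differentiable_smooth_function[OF True assms(2)] assms(3) by (simp add: frechet_derivative_works)
    have "((\<lambda>p. (f \<circ> param) (?t p)) has_derivative
        (\<lambda>w. frechet_derivative (f \<circ> param) (at (?t (\<kappa> x))) (frechet_derivative ?t (at (\<kappa> x)) w))) (at (\<kappa> x))"
      by (rule has_derivative_compose[OF t f])
    then have "frechet_derivative (\<lambda>p. (f \<circ> param) (?t p)) (at (\<kappa> x)) =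
        (\<lambda>w. frechet_derivative (f \<circ> param) (at (?t (\<kappa> x))) (frechet_derivative ?t (at (\<kappa> x)) w))"
      by (rule frechet_derivative_at[symmetric])
    moreover have "coord_tvec \<A> (V, \<kappa>) x u f = frechet_derivative (\<lambda>p. (f \<circ> param) (?t p)) (at (\<kappa> x)) u"
      by (rule v.coord_tvec_local[OF True oW]) (use assms in auto)
    ultimately show ?thesis using assms(3) by (simp add: coord_tvec_eq[OF True])
  qed (simp add: coord_tvec_def)
  then show ?thesis by blast
qed

text \<open>
  By the chain rule, one chart around the point gives all tangent vectors, although the tangent
  space collects those of every chart.
\<close>

lemma tangent_space_eq_range:
  assumes "x \<in> U" shows "tangent_space \<A> x = range (coord_tvec \<A> (U, \<phi>) x)"
  using coord_tvec_change_chart[OF _ assms] chart assms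
  unfolding tangent_space_def by fastforce

section \<open>Vector fields in a chart\<close>

definition principal_part :: "('m \<Rightarrow> 'm tvec) \<Rightarrow> 'e \<Rightarrow> 'e"
  where "principal_part X p = inv (coord_tvec \<A> (U, \<phi>) (param p)) (X (param p))"

lemma coord_tvec_principal_part:
  assumes "X \<in> vector_fields \<A>" "x \<in> U"
  shows "coord_tvec \<A> (U, \<phi>) x (principal_part X (\<phi> x)) = X x"
proof -
  have "X x \<in> range (coord_tvec \<A> (U, \<phi>) x)"
    using assms(1) unfolding tangent_space_eq_range[OF assms(2), symmetric] by (simp add: vector_fields_def)
  then show ?thesis using assms(2) by (simp add: principal_part_def f_inv_into_f)
qed

lemma vector_field_coordinate:
  assumes "X \<in> vector_fields \<A>" "x \<in> W"
    and "f \<in> smooth_functions \<A>" "open W" "W \<subseteq> U" "\<And>y. y \<in> W \<Longrightarrow> f y = \<phi> y \<bullet> e"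
  shows "X x f = principal_part X (\<phi> x) \<bullet> e"
  using coord_tvec_coordinate[OF assms(3-5,2,6)] coord_tvec_principal_part[of X x] assms by (metis subsetD)

lemma Ck_on_principal_part:
  assumes X: "X \<in> vector_fields \<A>"
  shows "Ck_on k (\<phi> ` U) (principal_part X)"
proof (rule Ck_on_locally)
  fix p assume "p \<in> \<phi> ` U"
  then obtain x where x: "x \<in> U" "p = \<phi> x" by blast
  obtain f W where W: "open W" "x \<in> W" "W \<subseteq> U" "\<And>e. f e \<in> smooth_functions \<A>"
    "\<And>e y. y \<in> W \<Longrightarrow> f e y = \<phi> y \<bullet> e"
    by (rule coordinate_functions[OF x(1)]) (rule that)
  have oW: "open (\<phi> ` W)" by (rule open_image[OF W(3,1)])
  have "Ck_on k (\<phi> ` W) (\<lambda>q. principal_part X q \<bullet> e)" for e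
  proof (rule Ck_on_cong[OF oW])
    have "(\<lambda>y. X y (f e)) \<in> smooth_functions \<A>"
      using X W(4) by (simp add: vector_fields_def)
    then show "Ck_on k (\<phi> ` W) ((\<lambda>y. X y (f e)) \<circ> param)"
      using W(3) by (intro Ck_on_subset[OF Ck_on_smooth_function]) auto
    show "((\<lambda>y. X y (f e)) \<circ> param) q = principal_part X q \<bullet> e" if "q \<in> \<phi> ` W" for q
      using that W(3) vector_field_coordinate[OF X _ W(4,1,3,5)] by auto
  qed
  then have "Ck_on k (\<phi> ` W) (\<lambda>q. \<Sum>e\<in>Basis. (principal_part X q \<bullet> e) *\<^sub>R e)"
    by (intro Ck_on_sum oW bounded_bilinear.Ck_on[OF bounded_bilinear_scaleR] Ck_on_const) auto
  then have "Ck_on k (\<phi> ` W) (principal_part X)" by (simp add: euclidean_representation)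
  then show "\<exists>T. open T \<and> p \<in> T \<and> Ck_on k T (principal_part X)"
    using oW x W(2) by blast
qed

lemma principal_part_has_derivative:
  assumes "X \<in> vector_fields \<A>" "p \<in> \<phi> ` U"
  shows "(principal_part X has_derivative frechet_derivative (principal_part X) (at p)) (at p)"
  using Ck_on_principal_part[OF assms(1), of "Suc 0"] assms(2)
  by (auto simp: Ck_on_Suc_iff_has_derivative)

text \<open>
  As \<open>[X, Y]\<close> is itself given to be a vector field, its components are its values on coordinate
  functions. There \<open>Y f\<close> is a component of the principal part of \<open>Y\<close>, and \<open>X\<close> acts on it by
  differentiation along the principal part of \<open>X\<close>.
\<close>

lemma principal_part_lie_bracket:
  assumes X: "X \<in> vector_fields \<A>" and Y: "Y \<in> vector_fields \<A>"
    and XY: "lie_bracket X Y \<in> vector_fields \<A>" and "p \<in> \<phi> ` U"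
  shows "principal_part (lie_bracket X Y) p =
    frechet_derivative (principal_part Y) (at p) (principal_part X p) -
    frechet_derivative (principal_part X) (at p) (principal_part Y p)"
proof -
  obtain x where x: "x \<in> U" "p = \<phi> x" using assms(4) by blast
  obtain f W where W: "open W" "x \<in> W" "W \<subseteq> U" "\<And>e. f e \<in> smooth_functions \<A>"
    "\<And>e y. y \<in> W \<Longrightarrow> f e y = \<phi> y \<bullet> e"
    by (rule coordinate_functions[OF x(1)]) (rule that)
  have app: "Z1 x (\<lambda>y. Z2 y (f e)) = frechet_derivative (principal_part Z2) (at p) (principal_part Z1 p) \<bullet> e"
    if Z1: "Z1 \<in> vector_fields \<A>" and Z2: "Z2 \<in> vector_fields \<A>" for Z1 Z2 e
  proof -
    have "Z1 x (\<lambda>y. Z2 y (f e)) = coord_tvec \<A> (U, \<phi>) x (principal_part Z1 p) (\<lambda>y. Z2 y (f e))"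
      using coord_tvec_principal_part[OF Z1 x(1)] x(2) by simp
    also have "\<dots> = frechet_derivative (\<lambda>q. principal_part Z2 q \<bullet> e) (at (\<phi> x)) (principal_part Z1 p)"
      by (rule coord_tvec_local[OF _ W(1,3,2)])
         (use Z2 W(4) vector_field_coordinate[OF Z2 _ W(4,1,3,5)] in \<open>auto simp: vector_fields_def\<close>)
    also have "((\<lambda>q. principal_part Z2 q \<bullet> e) has_derivative
        (\<lambda>v. frechet_derivative (principal_part Z2) (at p) v \<bullet> e)) (at p)"
      by (rule bounded_linear.has_derivative[OF bounded_linear_inner_left principal_part_has_derivative[OF Z2 assms(4)]])
    then have "frechet_derivative (\<lambda>q. principal_part Z2 q \<bullet> e) (at (\<phi> x)) =
        (\<lambda>v. frechet_derivative (principal_part Z2) (at p) v \<bullet> e)"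
      unfolding x(2) by (rule frechet_derivative_at[symmetric])
    finally show ?thesis .
  qed
  have "principal_part (lie_bracket X Y) p \<bullet> e = lie_bracket X Y x (f e)" for e
    using vector_field_coordinate[OF XY W(2,4,1,3,5)] x(2) by simp
  then have "principal_part (lie_bracket X Y) p \<bullet> e =
      (frechet_derivative (principal_part Y) (at p) (principal_part X p) -
       frechet_derivative (principal_part X) (at p) (principal_part Y p)) \<bullet> e" for e
    by (simp add: lie_bracket_def app[OF X Y] app[OF Y X] inner_diff_left)
  then show ?thesis by (rule euclidean_eqI)
qed

lemma integral_curve_in_chart:
  assumes X: "X \<in> vector_fields \<A>" and \<gamma>: "integral_curve \<A> X I \<gamma>" and t: "t \<in> I" "\<gamma> t \<in> U"
  shows "((\<phi> \<circ> \<gamma>) has_vector_derivative principal_part X (\<phi> (\<gamma> t))) (at t)"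
proof -
  obtain f W where W: "open W" "\<gamma> t \<in> W" "W \<subseteq> U" "\<And>e. f e \<in> smooth_functions \<A>"
    "\<And>e y. y \<in> W \<Longrightarrow> f e y = \<phi> y \<bullet> e"
    by (rule coordinate_functions[OF t(2)]) (rule that)
  have oJ: "open (I \<inter> \<gamma> -` W)"
    using \<gamma> W(1) by (intro continuous_open_preimage) (auto simp: integral_curve_def)
  have "((\<lambda>s. (\<phi> \<circ> \<gamma>) s \<bullet> e) has_derivative (\<lambda>s. (s *\<^sub>R principal_part X (\<phi> (\<gamma> t))) \<bullet> e)) (at t)" for e
  proof (rule has_derivative_transform_within_open[OF _ oJ])
    have "(f e \<circ> \<gamma> has_real_derivative X (\<gamma> t) (f e)) (at t)"
      using \<gamma> t(1) W(4) by (simp add: integral_curve_def)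
    then have "(f e \<circ> \<gamma> has_real_derivative principal_part X (\<phi> (\<gamma> t)) \<bullet> e) (at t)"
      by (simp only: vector_field_coordinate[OF X W(2,4,1,3,5)])
    then show "(f e \<circ> \<gamma> has_derivative (\<lambda>s. (s *\<^sub>R principal_part X (\<phi> (\<gamma> t))) \<bullet> e)) (at t)"
      unfolding has_field_derivative_def by (rule has_derivative_eq_rhs) (simp add: fun_eq_iff)
  qed (use t W in auto)
  then show ?thesis
    unfolding has_vector_derivative_def by (subst has_derivative_componentwise_within) blast
qed

end

section \<open>Frames of sections\<close>

context manifold
begin

lemma chart_at: obtains U \<phi> where "manifold_chart \<A> U \<phi>" "x \<in> U"
proof -
  have "x \<in> (\<Union>c\<in>\<A>. fst c)" using atlas by (simp add: smooth_atlas_def)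
  then obtain U \<phi> where c: "(U, \<phi>) \<in> \<A>" "x \<in> U" by fastforce
  then have "manifold_chart \<A> U \<phi>" by unfold_locales
  then show ?thesis using c that by blast
qed

lemma smooth_functions_mult:
  assumes "f \<in> smooth_functions \<A>" "g \<in> smooth_functions \<A>"
  shows "(\<lambda>x. f x * g x) \<in> smooth_functions \<A>"
proof -
  have "Ck_on k (\<phi> ` U) ((\<lambda>x. f x * g x) \<circ> inv_into U \<phi>)" if "(U, \<phi>) \<in> \<A>" for U \<phi> k
  proof -
    interpret manifold_chart \<A> U \<phi> by unfold_locales (rule that)
    show ?thesis
      using bounded_bilinear.Ck_on[OF bounded_bilinear_mult open_range
        Ck_on_smooth_function[OF assms(1)] Ck_on_smooth_function[OF assms(2)]]
      by (simp add: comp_def)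
  qed
  then show ?thesis by (auto simp: smooth_functions_def smooth_on_def)
qed

lemma vector_fields_scale:
  assumes "\<rho> \<in> smooth_functions \<A>" "Y \<in> vector_fields \<A>"
  shows "(\<lambda>x. \<rho> x *\<^sub>R Y x) \<in> vector_fields \<A>"
proof -
  have "\<rho> x *\<^sub>R Y x \<in> tangent_space \<A> x" for x
  proof -
    obtain U \<phi> where "manifold_chart \<A> U \<phi>" and x: "x \<in> U" by (rule chart_at) (rule that)
    then interpret manifold_chart \<A> U \<phi> by simp
    have "Y x \<in> range (coord_tvec \<A> (U, \<phi>) x)"
      using assms(2) unfolding tangent_space_eq_range[OF x, symmetric] by (simp add: vector_fields_def)
    then obtain u where "Y x = coord_tvec \<A> (U, \<phi>) x u" by blast
    then have "\<rho> x *\<^sub>R Y x = coord_tvec \<A> (U, \<phi>) x (\<rho> x *\<^sub>R u)"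
      by (simp only: linear_scale[OF linear_coord_tvec[OF x]])
    then show ?thesis unfolding tangent_space_eq_range[OF x] by simp
  qed
  moreover have "(\<lambda>x. (\<rho> x *\<^sub>R Y x) f) \<in> smooth_functions \<A>" if "f \<in> smooth_functions \<A>" for f
    using smooth_functions_mult[OF assms(1)] assms(2) that
    by (simp add: vector_fields_def scaleR_fun_def)
  ultimately show ?thesis by (simp add: vector_fields_def)
qed

text \<open>
  The local frame in the definition of a subbundle consists of global vector fields that are
  tangent to the subbundle only near the point. Multiplication by a cutoff function makes them
  global sections, to which the bracket condition applies.
\<close>

lemma subbundle_frame_of_sections:
  assumes "subbundle \<A> r E"
  obtains Y W where "open W" "x0 \<in> W" "\<And>i. i < r \<Longrightarrow> Y i \<in> sections \<A> E"
    "\<And>x. x \<in> W \<Longrightarrow> E x = span ((\<lambda>i. Y i x) ` {..<r})"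
proof -
  obtain N Z where N: "open N" "x0 \<in> N" and Z: "\<And>i. i < r \<Longrightarrow> Z i \<in> vector_fields \<A>"
    and span: "\<And>y. y \<in> N \<Longrightarrow> E y = span ((\<lambda>i. Z i y) ` {..<r})"
    using assms unfolding subbundle_def by metis
  obtain U \<phi> where "manifold_chart \<A> U \<phi>" and x: "x0 \<in> U" by (rule chart_at) (rule that)
  then interpret manifold_chart \<A> U \<phi> by simp
  obtain \<rho> W where \<rho>: "\<rho> \<in> smooth_functions \<A>" and W: "open W" "x0 \<in> W" "W \<subseteq> U \<inter> N"
    "\<And>y. y \<in> W \<Longrightarrow> \<rho> y = 1" and zero: "\<And>y. y \<notin> N \<Longrightarrow> \<rho> y = 0"
    and "\<forall>h. smooth_on (\<phi> ` U) h \<longrightarrow> (\<lambda>y. if y \<in> U then \<rho> y * h (\<phi> y) else 0) \<in> smooth_functions \<A>"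
    by (rule cutoff[OF x N]) (rule that)
  define Y where "Y i y = \<rho> y *\<^sub>R Z i y" for i y
  have "Y i \<in> sections \<A> E" if "i < r" for i
  proof -
    have "Y i y \<in> E y" for y
    proof (cases "y \<in> N")
      case True
      then show ?thesis using that unfolding Y_def span[OF True] by (intro span_scale span_base) auto
    next
      case False
      have "subspace (E y)" using assms by (simp add: subbundle_def)
      then show ?thesis using zero[OF False] subspace_0 by (simp add: Y_def)
    qed
    then show ?thesis
      using vector_fields_scale[OF \<rho> Z[OF that]] by (simp add: sections_def Y_def[abs_def])
  qed
  moreover have "E y = span ((\<lambda>i. Y i y) ` {..<r})" if "y \<in> W" for y
    using span[of y] W(3,4) that by (auto simp: Y_def)
  ultimately show ?thesis using W(1,2) that by blast
qed

end

text \<open>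
  Since \<open>coord_tvec\<close> is a linear isomorphism onto the tangent space, the principal parts span a
  space of dimension \<open>r\<close>; being \<open>r\<close> in number, they are independent.
\<close>

lemma (in manifold_chart) principal_part_frame:
  assumes Y: "\<And>i. i < r \<Longrightarrow> Y i \<in> vector_fields \<A>" and x: "x \<in> U"
    and E: "E = span ((\<lambda>i. Y i x) ` {..<r})" "dim E = r"
  shows "independent ((\<lambda>i. principal_part (Y i) (\<phi> x)) ` {..<r})" (is "independent ?B")
    and "inj_on (\<lambda>i. principal_part (Y i) (\<phi> x)) {..<r}"
    and "coord_tvec \<A> (U, \<phi>) x v \<in> E \<longleftrightarrow> v \<in> span ((\<lambda>i. principal_part (Y i) (\<phi> x)) ` {..<r})"
proof -
  let ?T = "coord_tvec \<A> (U, \<phi>) x"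
  have "(\<lambda>i. Y i x) ` {..<r} = ?T ` ?B"
    unfolding image_image using coord_tvec_principal_part[OF Y x] by (intro image_cong) auto
  then have ET: "E = ?T ` span ?B"
    unfolding E(1) using linear_span_image[OF linear_coord_tvec[OF x]] by metis
  have inj: "inj_on ?T S" for S using inj_coord_tvec[OF x] by (rule inj_on_subset) simp
  then show "?T v \<in> E \<longleftrightarrow> v \<in> span ?B"
    unfolding ET using inj_coord_tvec[OF x] by (simp add: inj_image_mem_iff)
  have "r = dim (span ?B)"
    using eucl.dim_image_eq[OF linear_coord_tvec[OF x] inj, of "span ?B"] E(2) ET by simp
  then have dim: "dim ?B = r" by simp
  have "card ?B \<le> r" using card_image_le[of "{..<r}" "\<lambda>i. principal_part (Y i) (\<phi> x)"] by simp
  moreover have "dim ?B \<le> card ?B" by (rule dim_le_card) (auto simp: span_superset)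
  ultimately have card: "card ?B = r" using dim by simp
  show "independent ?B" using dim card by (intro card_le_dim_spanning[of _ ?B] span_superset) auto
  show "inj_on (\<lambda>i. principal_part (Y i) (\<phi> x)) {..<r}"
    using card by (intro eq_card_imp_inj_on) auto
qed

section \<open>Invariance of the locus where a field is tangent to a subbundle\<close>

lemma Ck_on_locally_bounded_derivative:
  fixes f :: "'a::euclidean_space \<Rightarrow> 'b::real_normed_vector"
  assumes f: "Ck_on (Suc 0) S f" and S: "open S" "p \<in> S"
  obtains K T where "open T" "p \<in> T" "T \<subseteq> S" "K \<ge> 0"
    "\<And>q v. q \<in> T \<Longrightarrow> norm (frechet_derivative f (at q) v) \<le> K * norm v"
proof -
  define B where "B q = (\<Sum>b\<in>Basis. norm (frechet_derivative f (at q) b))" for q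
  have "continuous_on S B"
    unfolding B_def using f by (intro continuous_intros) (simp add: Ck_on.simps(2))
  define T where "T = {q \<in> S. B q < B p + 1}"
  have "T = S \<inter> B -` {..<B p + 1}" by (auto simp: T_def)
  then have "open T" using continuous_open_preimage[OF \<open>continuous_on S B\<close> S(1)] by simp
  moreover have "B p \<ge> 0" by (simp add: B_def sum_nonneg)
  moreover have "norm (frechet_derivative f (at q) v) \<le> (B p + 1) * norm v" if "q \<in> T" for q v
  proof -
    have "f differentiable (at q)" using f that by (simp add: T_def Ck_on.simps(2))
    then have "norm (frechet_derivative f (at q) v) \<le>
        (\<Sum>b\<in>Basis. norm ((v \<bullet> b) *\<^sub>R frechet_derivative f (at q) b))"
      using frechet_derivative_Basis_sum[of f q v] norm_sum by metis
    also have "\<dots> \<le> (\<Sum>b\<in>Basis. norm (frechet_derivative f (at q) b) * norm v)"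
      by (intro sum_mono) (simp add: Basis_le_norm mult.commute mult_right_mono)
    also have "\<dots> = B q * norm v" by (simp add: B_def sum_distrib_right)
    also have "\<dots> \<le> (B p + 1) * norm v"
      using that by (intro mult_right_mono) (auto simp: T_def)
    finally show ?thesis .
  qed
  ultimately show ?thesis using that[of T "B p + 1"] S(2) by (auto simp: T_def)
qed

text \<open>
  Near each time \<open>t0\<close>, choose a chart at \<open>\<gamma> t0\<close> and a frame of sections of \<open>E\<close>. In the chart the bracket
  condition is the hypothesis of \<open>invariant_span_along_linear_flow\<close> on the correction terms, and the
  same formula with \<open>X\<close> in place of the sections is the linearised equation for \<open>X\<close> along \<open>\<gamma>\<close>. So
  tangency to \<open>E\<close> holds either at all times near \<open>t0\<close> or at none of them.
\<close>

lemma (in manifold) flow_invariant_locus: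
  assumes E: "subbundle \<A> r E" and X: "X \<in> vector_fields \<A>" and pres: "preserves_sections \<A> X E"
  shows "flow_invariant \<A> X (locus E X)"
proof -
  have transport: "X (\<gamma> b) \<in> E (\<gamma> b)"
    if \<gamma>: "integral_curve \<A> X I \<gamma>" and ab: "a \<in> I" "b \<in> I" and start: "X (\<gamma> a) \<in> E (\<gamma> a)" for I \<gamma> a b
  proof (rule connected_induction_simple[where P = "\<lambda>t. X (\<gamma> t) \<in> E (\<gamma> t)", OF _ ab start])
    have I: "open I" "is_interval I" "continuous_on I \<gamma>" using \<gamma> by (auto simp: integral_curve_def)
    then show "connected I" by (simp add: is_interval_connected)
    fix t0 assume t0: "t0 \<in> I"
    obtain Y W where W: "open W" "\<gamma> t0 \<in> W" and Y: "\<And>i. i < r \<Longrightarrow> Y i \<in> sections \<A> E"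
      and span: "\<And>x. x \<in> W \<Longrightarrow> E x = span ((\<lambda>i. Y i x) ` {..<r})"
      by (rule subbundle_frame_of_sections[OF E]) (rule that)
    obtain U \<phi> where "manifold_chart \<A> U \<phi>" and x: "\<gamma> t0 \<in> U" by (rule chart_at) (rule that)
    then interpret manifold_chart \<A> U \<phi> by simp
    define \<xi> where "\<xi> = principal_part X"
    define y where "y i = principal_part (Y i)" for i
    obtain K T where T: "open T" "\<phi> (\<gamma> t0) \<in> T" "T \<subseteq> \<phi> ` U" and K: "K \<ge> 0"
      "\<And>q v. q \<in> T \<Longrightarrow> norm (frechet_derivative \<xi> (at q) v) \<le> K * norm v"
      by (rule Ck_on_locally_bounded_derivative[OF Ck_on_principal_part[OF X] open_range imageI[OF x],
            folded \<xi>_def]) (rule that)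
    have "open (I \<inter> \<gamma> -` (W \<inter> (U \<inter> \<phi> -` T)))"
      by (rule continuous_open_preimage[OF I(3,1) open_Int[OF W(1) open_preimage[OF T(1)]]])
    moreover have "t0 \<in> I \<inter> \<gamma> -` (W \<inter> (U \<inter> \<phi> -` T))" using t0 x W(2) T(2) by simp
    ultimately have "\<exists>\<delta>>0. ball t0 \<delta> \<subseteq> I \<inter> \<gamma> -` (W \<inter> (U \<inter> \<phi> -` T))"
      by (simp only: open_contains_ball_eq)
    then obtain \<delta> where "\<delta> > 0" and \<delta>: "ball t0 \<delta> \<subseteq> I \<inter> \<gamma> -` (W \<inter> (U \<inter> \<phi> -` T))"
      by blast
    define J where "J = ball t0 \<delta>"
    have J: "t \<in> I" "\<gamma> t \<in> W" "\<gamma> t \<in> U" "\<phi> (\<gamma> t) \<in> T" if "t \<in> J" for t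
      using \<delta> that by (auto simp: J_def)
    have Yv: "Y i \<in> vector_fields \<A>" "Y i x \<in> E x" "lie_bracket X (Y i) \<in> vector_fields \<A>"
      "lie_bracket X (Y i) x \<in> E x" if "i < r" for i x
      using Y[OF that] pres by (auto simp: preserves_sections_def sections_def)
    have dim: "dim (E x) = r" for x using E by (simp add: subbundle_def)
    note frame = principal_part_frame[OF Yv(1) J(3) span[OF J(2)] dim, folded y_def]
    have deriv: "((\<lambda>t. principal_part Z (\<phi> (\<gamma> t))) has_vector_derivative
        frechet_derivative (principal_part Z) (at (\<phi> (\<gamma> t))) (\<xi> (\<phi> (\<gamma> t)))) (at t)"
      if "t \<in> J" and Z: "Z \<in> vector_fields \<A>" for t Z
    proof -
      have "((\<phi> \<circ> \<gamma>) has_vector_derivative \<xi> (\<phi> (\<gamma> t))) (at t)"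
        unfolding \<xi>_def using integral_curve_in_chart[OF X \<gamma>] J[OF that(1)] by blast
      then have "(principal_part Z \<circ> (\<phi> \<circ> \<gamma>) has_vector_derivative
          frechet_derivative (principal_part Z) (at ((\<phi> \<circ> \<gamma>) t)) (\<xi> (\<phi> (\<gamma> t)))) (at t)"
        by (rule vector_derivative_diff_chain_within)
           (use principal_part_has_derivative[OF Z] J[OF that(1)] in \<open>auto intro: has_derivative_at_withinI\<close>)
      then show ?thesis by (simp add: comp_def)
    qed
    have mem: "X (\<gamma> t) \<in> E (\<gamma> t) \<longleftrightarrow> \<xi> (\<phi> (\<gamma> t)) \<in> span ((\<lambda>i. y i (\<phi> (\<gamma> t))) ` {..<r})"
      if "t \<in> J" for t
      using frame(3)[OF _ that that] coord_tvec_principal_part[OF X J(3)[OF that]] by (metis \<xi>_def)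
    have "X (\<gamma> t) \<in> E (\<gamma> t)" if st: "s \<in> J" "t \<in> J" "X (\<gamma> s) \<in> E (\<gamma> s)" for s t
    proof -
      have "\<xi> (\<phi> (\<gamma> t)) \<in> span ((\<lambda>i. y i (\<phi> (\<gamma> t))) ` {..<r})"
      proof (rule invariant_span_along_linear_flow[where J = J and K = K
            and L = "\<lambda>t. frechet_derivative \<xi> (at (\<phi> (\<gamma> t)))" and u = "\<lambda>t. \<xi> (\<phi> (\<gamma> t))"
            and y = "\<lambda>i t. y i (\<phi> (\<gamma> t))" and r = r
            and e = "\<lambda>i t. principal_part (lie_bracket X (Y i)) (\<phi> (\<gamma> t))"])
        show "is_interval J" by (simp add: J_def is_interval_ball_real)
        show "\<xi> (\<phi> (\<gamma> s)) \<in> span ((\<lambda>i. y i (\<phi> (\<gamma> s))) ` {..<r})" using mem st by blast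
      next
        fix t assume t: "t \<in> J"
        show "linear (frechet_derivative \<xi> (at (\<phi> (\<gamma> t))))"
          using principal_part_has_derivative[OF X, of "\<phi> (\<gamma> t)"] J(3)[OF t]
          unfolding \<xi>_def by (intro linear_frechet_derivative) (auto simp: differentiable_def)
        show "((\<lambda>t. \<xi> (\<phi> (\<gamma> t))) has_vector_derivative
            frechet_derivative \<xi> (at (\<phi> (\<gamma> t))) (\<xi> (\<phi> (\<gamma> t)))) (at t)"
          using deriv[OF t X] by (simp add: \<xi>_def)
        show "norm (frechet_derivative \<xi> (at (\<phi> (\<gamma> t))) v) \<le> K * norm v" for v
          using K(2) J(4)[OF t] by blast
        show "independent ((\<lambda>i. y i (\<phi> (\<gamma> t))) ` {..<r})" "inj_on (\<lambda>i. y i (\<phi> (\<gamma> t))) {..<r}"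
          using frame(1,2)[OF _ t t] by blast+
        fix i assume i: "i < r"
        show "((\<lambda>t. y i (\<phi> (\<gamma> t))) has_vector_derivative
            frechet_derivative \<xi> (at (\<phi> (\<gamma> t))) (y i (\<phi> (\<gamma> t))) +
            principal_part (lie_bracket X (Y i)) (\<phi> (\<gamma> t))) (at t)"
          using deriv[OF t Yv(1)[OF i]] principal_part_lie_bracket[OF X Yv(1)[OF i] Yv(3)[OF i]] J(3)[OF t]
          by (simp add: \<xi>_def y_def)
        show "principal_part (lie_bracket X (Y i)) (\<phi> (\<gamma> t)) \<in> span ((\<lambda>i. y i (\<phi> (\<gamma> t))) ` {..<r})"
          using frame(3)[OF _ t t] coord_tvec_principal_part[OF Yv(3)[OF i] J(3)[OF t]] Yv(4)[OF i] by metis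
      qed (use st K in auto)
      then show ?thesis using mem st by blast
    qed
    moreover have "openin (top_of_set I) J" "t0 \<in> J"
      using J(1) \<open>\<delta> > 0\<close> by (auto simp: J_def openin_open_eq I(1))
    ultimately show "\<exists>T. openin (top_of_set I) T \<and> t0 \<in> T \<and>
        (\<forall>x\<in>T. \<forall>y\<in>T. X (\<gamma> x) \<in> E (\<gamma> x) \<longrightarrow> X (\<gamma> y) \<in> E (\<gamma> y))"
      by blast
  qed
  show ?thesis unfolding flow_invariant_def
  proof (intro ballI allI impI)
    fix x t y assume x: "x \<in> locus E X" and "local_flow \<A> X t x y"
    then obtain I \<gamma> where \<gamma>: "integral_curve \<A> X I \<gamma>" "0 \<in> I" "t \<in> I" "\<gamma> 0 = x" "\<gamma> t = y"
      unfolding local_flow_def by blast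
    show "y \<in> locus E X"
      using transport[OF \<gamma>(1-3)] x \<gamma>(4,5) by (simp add: locus_def)
  qed
qed

section \<open>The loci of a k-contact vector field\<close>

theorem proposition9p2:
  fixes \<A> :: "('m::{t2_space, second_countable_topology}, 'e::euclidean_space) chart set"
    and \<eta> :: "'m \<Rightarrow> 'm tvec \<Rightarrow> real ^ 'k"
    and X :: "'m \<Rightarrow> 'm tvec"
  defines "D \<equiv> ker_form \<A> \<eta>"
  assumes "k_contact_manifold \<A> \<eta>"
    and "k_contact_field \<A> D X"
  shows "locus D X = hamiltonian \<eta> X -` {0} \<and>
    flow_invariant \<A> X (locus D X) \<and>
    (\<forall>P. polarisation \<A> D P \<and> polarised_k_contact_field \<A> D P X \<longrightarrow>
       flow_invariant \<A> X (locus P X))"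
proof (intro conjI allI impI)
  interpret manifold \<A>
    using assms(2) by unfold_locales (simp add: k_contact_manifold_def)
  have X: "X \<in> vector_fields \<A>" "preserves_sections \<A> X D"
    using assms(3) by (simp_all add: k_contact_field_def)
  then have "X x \<in> tangent_space \<A> x" for x by (simp add: vector_fields_def)
  then show "locus D X = hamiltonian \<eta> X -` {0}"
    by (auto simp: locus_def hamiltonian_def D_def ker_form_def component_def vec_eq_iff)
  obtain r where "subbundle \<A> r D"
    using assms(2) unfolding k_contact_manifold_def D_def by blast
  then show "flow_invariant \<A> X (locus D X)" using X by (rule flow_invariant_locus)
  fix P assume P: "polarisation \<A> D P \<and> polarised_k_contact_field \<A> D P X"
  then obtain r' where "subbundle \<A> r' P"
    unfolding polarisation_def integrable_legendrian_def by blast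
  moreover have "preserves_sections \<A> X P" using P by (simp add: polarised_k_contact_field_def)
  ultimately show "flow_invariant \<A> X (locus P X)" using X(1) flow_invariant_locus by blast
qed

end
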